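(* Let $G$ be a compact connected abelian group with normalized Haar measure $\mu$, and let $\Gamma$ be a submonoid of the dual group $\widehat G$ (i.e. the trivial character $1\in\Gamma$ and $\Gamma$ is closed under the group operation). Assume (i) $\Gamma\ne\{1\}$ and (ii) $\Gamma$ is a Riesz set. Then the orthogonal projection $\Pi_\Gamma:L^2(G,\mu)\to H_\Gamma$ cannot be extended to a bounded linear operator on $L^1(G,\mu)$.
   Context: $\widehat G$ is the group of continuous homomorphisms $G\to\{|z|=1\}$. The Fourier transform of $f\in L^1(G,\mu)$ is $\mathcal{F}f(\xi)=\int_G f\,\overline{\xi}\,d\mu$, and of a regular complex Borel measure $\sigma$ is $\mathcal{F}\sigma(\xi)=\int_G\overline{\xi}\,d\sigma$. $H_\Gamma=\{f\in L^2(G,\mu):\mathcal{F}f(\xi)=0\ \forall\xi\notin\Gamma\}$. A set $\Gamma\subseteq\widehat G$ is a Riesz set if every regular complex Borel measure $\sigma$ on $G$ with $\mathcal{F}\sigma$ vanishing off $\Gamma$ is absolutely continuous with respect to $\mu$. *)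

theory Defs
  imports "HOL-Analysis.Analysis"
begin

text \<open>The compact abelian group G is a type of class topological_ab_group_add
  (written additively) with the t2 (Hausdorff) property, UNIV compact and connected.\<close>

definition characters :: "('a::topological_ab_group_add \<Rightarrow> complex) set" where
  "characters = {\<xi>. continuous_on UNIV \<xi> \<and> (\<forall>x. cmod (\<xi> x) = 1)
                     \<and> (\<forall>x y. \<xi> (x + y) = \<xi> x * \<xi> y)}"

definition regular_measure :: "'a::topological_space measure \<Rightarrow> bool" where
  "regular_measure \<nu> \<longleftrightarrow> sets \<nu> = sets borel \<and> finite_measure \<nu>
     \<and> (\<forall>A\<in>sets borel. emeasure \<nu> A = (INF U\<in>{U. open U \<and> A \<subseteq> U}. emeasure \<nu> U))
     \<and> (\<forall>U. open U \<longrightarrow> emeasure \<nu> U = (SUP K\<in>{K. compact K \<and> K \<subseteq> U}. emeasure \<nu> K))"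

definition haar_prob :: "'a::topological_ab_group_add measure \<Rightarrow> bool" where
  "haar_prob \<mu> \<longleftrightarrow> regular_measure \<mu> \<and> emeasure \<mu> (space \<mu>) = 1
     \<and> (\<forall>a A. A \<in> sets borel \<longrightarrow> emeasure \<mu> ((\<lambda>x. a + x) ` A) = emeasure \<mu> A)"

text \<open>A regular complex Borel measure is represented as
  sigma = (m1 - m2) + i (m3 - m4) with m1..m4 finite regular positive Borel measures
  (every regular complex measure has such a Jordan decomposition).\<close>
type_synonym 'a cmeasure = "'a measure \<times> 'a measure \<times> 'a measure \<times> 'a measure"

definition cm_regular :: "'a::topological_space cmeasure \<Rightarrow> bool" where
  "cm_regular \<sigma> = (case \<sigma> of (m1, m2, m3, m4) \<Rightarrow>
     regular_measure m1 \<and> regular_measure m2 \<and> regular_measure m3 \<and> regular_measure m4)"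

definition cm_val :: "'a cmeasure \<Rightarrow> 'a set \<Rightarrow> complex" where
  "cm_val \<sigma> A = (case \<sigma> of (m1, m2, m3, m4) \<Rightarrow>
     complex_of_real (measure m1 A - measure m2 A) + \<i> * complex_of_real (measure m3 A - measure m4 A))"

definition cm_fourier :: "'a cmeasure \<Rightarrow> ('a \<Rightarrow> complex) \<Rightarrow> complex" where
  "cm_fourier \<sigma> \<xi> = (case \<sigma> of (m1, m2, m3, m4) \<Rightarrow>
     (\<integral>x. cnj (\<xi> x) \<partial>m1) - (\<integral>x. cnj (\<xi> x) \<partial>m2)
     + \<i> * ((\<integral>x. cnj (\<xi> x) \<partial>m3) - (\<integral>x. cnj (\<xi> x) \<partial>m4)))"

text \<open>Absolute continuity of a complex measure w.r.t. mu (equivalently: |sigma| << mu).\<close>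
definition cm_abs_cont :: "'a measure \<Rightarrow> 'a cmeasure \<Rightarrow> bool" where
  "cm_abs_cont \<mu> \<sigma> \<longleftrightarrow> (\<forall>A\<in>sets \<mu>. emeasure \<mu> A = 0 \<longrightarrow> cm_val \<sigma> A = 0)"

definition riesz_set :: "'a::topological_ab_group_add measure \<Rightarrow> ('a \<Rightarrow> complex) set \<Rightarrow> bool" where
  "riesz_set \<mu> \<Gamma> \<longleftrightarrow> (\<forall>\<sigma>. cm_regular \<sigma> \<longrightarrow> (\<forall>\<xi>\<in>characters - \<Gamma>. cm_fourier \<sigma> \<xi> = 0)
      \<longrightarrow> cm_abs_cont \<mu> \<sigma>)"

definition fourier :: "'a measure \<Rightarrow> ('a \<Rightarrow> complex) \<Rightarrow> ('a \<Rightarrow> complex) \<Rightarrow> complex" where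
  "fourier \<mu> f \<xi> = (\<integral>x. f x * cnj (\<xi> x) \<partial>\<mu>)"

definition L2 :: "'a measure \<Rightarrow> ('a \<Rightarrow> complex) set" where
  "L2 \<mu> = {f. f \<in> borel_measurable \<mu> \<and> integrable \<mu> (\<lambda>x. (cmod (f x))\<^sup>2)}"

definition L1norm :: "'a measure \<Rightarrow> ('a \<Rightarrow> complex) \<Rightarrow> real" where
  "L1norm \<mu> f = (\<integral>x. cmod (f x) \<partial>\<mu>)"

definition H_space :: "'a::topological_ab_group_add measure \<Rightarrow> ('a \<Rightarrow> complex) set \<Rightarrow> ('a \<Rightarrow> complex) set" where
  "H_space \<mu> \<Gamma> = {f \<in> L2 \<mu>. \<forall>\<xi>\<in>characters - \<Gamma>. fourier \<mu> f \<xi> = 0}"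

definition is_orth_proj :: "'a::topological_ab_group_add measure \<Rightarrow> ('a \<Rightarrow> complex) set
    \<Rightarrow> ('a \<Rightarrow> complex) \<Rightarrow> ('a \<Rightarrow> complex) \<Rightarrow> bool" where
  "is_orth_proj \<mu> \<Gamma> f g \<longleftrightarrow> g \<in> H_space \<mu> \<Gamma>
     \<and> (\<forall>h\<in>H_space \<mu> \<Gamma>. (\<integral>x. (f x - g x) * cnj (h x) \<partial>\<mu>) = 0)"

definition submonoid_dual :: "('a::topological_ab_group_add \<Rightarrow> complex) set \<Rightarrow> bool" where
  "submonoid_dual \<Gamma> \<longleftrightarrow> \<Gamma> \<subseteq> characters \<and> (\<lambda>x. 1) \<in> \<Gamma>
     \<and> (\<forall>\<xi>\<in>\<Gamma>. \<forall>\<eta>\<in>\<Gamma>. (\<lambda>x. \<xi> x * \<eta> x) \<in> \<Gamma>)"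

end

theory Submission
  imports Defs "HOL-Probability.Probability_Measure"
begin

text \<open>
  Pick a nontrivial character \<open>\<omega>\<close> in \<open>\<Gamma>\<close>; connectedness makes all its powers distinct.

  If the conjugate of \<open>\<omega>\<close> is not in \<open>\<Gamma>\<close>, no negative power of \<open>\<omega>\<close> is, so the projection maps the
  Fejer kernel in \<open>\<omega>\<close>, which has \<open>L\<^sup>1\<close> norm 1, to its analytic part, the Cesaro mean of the geometric
  series. A uniform \<open>L\<^sup>1\<close> bound for these would make \<open>1 / (1 - \<omega>)\<close> integrable by Fatou. Its Fourier
  coefficients along the powers of \<open>\<omega>\<close> would then be constant on either side of a jump of height 1,
  yet tend to 0 in mean on both sides.

  Otherwise all integer powers of \<open>\<omega>\<close> lie in \<open>\<Gamma>\<close>. A weak limit of the Fejer kernels in \<open>\<omega>\<close> is a regular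
  probability measure with spectrum in these powers; it is carried by the Haar null set \<open>\<omega> = 1\<close>, so
  \<open>\<Gamma>\<close> is not a Riesz set. The limit is obtained without the Riesz representation theorem: a pointwise
  cluster point of the measures, as set functions, is a content on compact sets, and this content
  induces a regular Borel measure.
\<close>

section \<open>Regular measures from contents\<close>

text \<open>The compact sets \<open>K - U\<close> and \<open>K - V\<close> are disjoint, so the
  Hausdorff property gives disjoint open \<open>A\<close> and \<open>B\<close> around them;
  \<open>K - A\<close> and \<open>K - B\<close> are the pieces. This carries subadditivity over from
  compact sets to open sets.\<close>

lemma compact_Un_open_split:
  fixes K :: "'a::t2_space set"
  assumes "compact K" "open U" "open V" "K \<subseteq> U \<union> V"
  obtains K1 K2 where "compact K1" "compact K2" "K1 \<subseteq> U" "K2 \<subseteq> V" "K = K1 \<union> K2"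
proof -
  have "compact (K - U)" "compact (K - V)" "disjnt (K - U) (K - V)"
    using assms by (auto simp: compact_diff disjnt_def)
  moreover have "Hausdorff_space (euclidean :: 'a topology)"
    by (metis Hausdorff_space_def UNIV_I disjnt_def hausdorff open_openin topspace_euclidean)
  ultimately obtain A B where AB: "open A" "open B" "K - U \<subseteq> A" "K - V \<subseteq> B" "disjnt A B"
    unfolding Hausdorff_space_compact_sets by (metis compactin_euclidean_iff open_openin)
  show thesis
  proof
    show "compact (K - A)" "compact (K - B)"
      using AB assms by (auto simp: compact_diff)
  qed (use AB assms in \<open>auto simp: disjnt_def\<close>)
qed

section \<open>From a content on compact sets to an outer measure\<close>

definition open_content :: "('a::topological_space set \<Rightarrow> ennreal) \<Rightarrow> 'a set \<Rightarrow> ennreal" where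
  "open_content m U = (SUP K\<in>{K. compact K \<and> K \<subseteq> U}. m K)"

text \<open>Second step of Halmos' extension: approximation from inside by compact sets on open sets
  first, then from outside by open sets on arbitrary sets.\<close>

definition content_outer :: "('a::topological_space set \<Rightarrow> ennreal) \<Rightarrow> 'a set \<Rightarrow> ennreal" where
  "content_outer m E = (INF U\<in>{U. open U \<and> E \<subseteq> U}. open_content m U)"

text \<open>The axioms are those that survive a pointwise limit of measures: finite additivity
  passes to the limit, countable additivity may be lost and is regained below from
  compactness.\<close>

locale compact_content =
  fixes m :: "'a::t2_space set \<Rightarrow> ennreal"
  assumes compact_UNIV: "compact (UNIV :: 'a set)"
    and content_empty: "m {} = 0"
    and content_mono: "\<And>K L. compact K \<Longrightarrow> compact L \<Longrightarrow> K \<subseteq> L \<Longrightarrow> m K \<le> m L"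
    and content_subadd: "\<And>K L. compact K \<Longrightarrow> compact L \<Longrightarrow> m (K \<union> L) \<le> m K + m L"
    and content_add: "\<And>K L. compact K \<Longrightarrow> compact L \<Longrightarrow> K \<inter> L = {} \<Longrightarrow> m (K \<union> L) = m K + m L"
    and content_finite: "m UNIV < \<infinity>"
begin

lemma content_le_open: "compact K \<Longrightarrow> K \<subseteq> U \<Longrightarrow> m K \<le> open_content m U"
  unfolding open_content_def by (rule SUP_upper) auto

lemma open_content_mono: "U \<subseteq> V \<Longrightarrow> open_content m U \<le> open_content m V"
  unfolding open_content_def by (rule SUP_subset_mono) auto

text \<open>Induction on the length of the cover: splitting \<open>K\<close> along the last open set
  leaves a compact piece covered by the others.\<close>

lemma content_finite_cover:
  assumes "\<And>i::nat. open (U i)" "compact K" "K \<subseteq> (\<Union>i<n. U i)"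
  shows "m K \<le> (\<Sum>i<n. open_content m (U i))"
  using assms(2,3)
proof (induction n arbitrary: K)
  case 0
  then show ?case by (simp add: content_empty)
next
  case (Suc n)
  have sub: "K \<subseteq> (\<Union>i<n. U i) \<union> U n"
    using Suc.prems(2) by (simp add: lessThan_Suc Un_commute)
  have "open (\<Union>i<n. U i)"
    using assms(1) by auto
  then obtain K1 K2 where K: "compact K1" "compact K2" "K1 \<subseteq> (\<Union>i<n. U i)" "K2 \<subseteq> U n" "K = K1 \<union> K2"
    by (rule compact_Un_open_split[OF Suc.prems(1) _ assms(1) sub])
  have "m K \<le> m K1 + m K2"
    using K content_subadd by simp
  also have "\<dots> \<le> (\<Sum>i<n. open_content m (U i)) + open_content m (U n)"
    by (intro add_mono content_le_open Suc.IH K)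
  finally show ?case by simp
qed

text \<open>Each compact subset of the union is already covered by finitely many of the
  \<open>U i\<close>; countable subadditivity comes from compactness alone.\<close>

lemma open_content_countable_subadd:
  assumes "\<And>i::nat. open (U i)"
  shows "open_content m (\<Union>i. U i) \<le> (\<Sum>i. open_content m (U i))"
  unfolding open_content_def[of m "\<Union>i. U i"]
proof (rule SUP_least, safe)
  fix K assume K: "compact K" "K \<subseteq> (\<Union>i. U i)"
  then obtain I where I: "finite I" "K \<subseteq> (\<Union>i\<in>I. U i)"
    using compactE_image[of K UNIV U] assms by auto
  then obtain n where "I \<subseteq> {..<n}"
    by (metis finite_nat_iff_bounded)
  with I have "K \<subseteq> (\<Union>i<n. U i)" by blast
  then have "m K \<le> (\<Sum>i<n. open_content m (U i))"
    using content_finite_cover assms K by blast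
  also have "\<dots> \<le> (\<Sum>i. open_content m (U i))"
    by (rule sum_le_suminf) auto
  finally show "m K \<le> (\<Sum>i. open_content m (U i))" .
qed

lemma content_outer_le: "open U \<Longrightarrow> E \<subseteq> U \<Longrightarrow> content_outer m E \<le> open_content m U"
  unfolding content_outer_def by (rule INF_lower) auto

lemma content_outer_open: "open U \<Longrightarrow> content_outer m U = open_content m U"
  by (rule antisym) (auto simp: content_outer_def intro!: INF_greatest INF_lower open_content_mono)

lemma content_outer_mono: "E \<subseteq> F \<Longrightarrow> content_outer m E \<le> content_outer m F"
  unfolding content_outer_def by (rule INF_superset_mono) auto

lemma content_outer_finite: "content_outer m E < \<infinity>"
proof -
  have "content_outer m E \<le> open_content m UNIV"
    by (rule content_outer_le) auto
  also have "\<dots> \<le> m UNIV"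
    unfolding open_content_def by (rule SUP_least) (auto intro: content_mono compact_UNIV)
  finally show ?thesis using content_finite by (meson order_le_less_trans)
qed

lemma content_outer_countable_subadd:
  fixes E :: "nat \<Rightarrow> 'a set"
  shows "content_outer m (\<Union>i. E i) \<le> (\<Sum>i. content_outer m (E i))"
proof (rule ennreal_le_epsilon)
  fix e :: real assume "0 < e"
  \<comment> \<open>The errors form a geometric series with sum \<open>e\<close>. Finiteness of the
    outer content makes the inequality strict, so a near-optimal open set exists.\<close>
  have "\<exists>U. open U \<and> E i \<subseteq> U \<and> open_content m U \<le> content_outer m (E i) + ennreal (e * (1/2)^Suc i)" for i
  proof -
    have "content_outer m (E i) < content_outer m (E i) + ennreal (e * (1/2)^Suc i)"
      using content_outer_finite[of "E i"] \<open>0 < e\<close>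
      by (simp add: ennreal_add_left_cancel_less less_top[symmetric])
    then show ?thesis
      unfolding content_outer_def[of m "E i"] INF_less_iff
      by (auto intro: less_imp_le)
  qed
  then obtain U where U: "\<And>i. open (U i)" "\<And>i. E i \<subseteq> U i"
    "\<And>i. open_content m (U i) \<le> content_outer m (E i) + ennreal (e * (1/2)^Suc i)"
    by metis
  have "(\<lambda>i. e * (1/2)^Suc i) sums (e * 1)"
    by (intro sums_mult power_half_series)
  then have e: "(\<Sum>i. ennreal (e * (1/2)^Suc i)) = ennreal e"
    using \<open>0 < e\<close> by (subst suminf_ennreal2) (auto simp: sums_iff)
  have "content_outer m (\<Union>i. E i) \<le> open_content m (\<Union>i. U i)"
    using U by (intro content_outer_le) auto
  also have "\<dots> \<le> (\<Sum>i. open_content m (U i))"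
    using U by (intro open_content_countable_subadd)
  also have "\<dots> \<le> (\<Sum>i. content_outer m (E i) + ennreal (e * (1/2)^Suc i))"
    using U by (intro suminf_le) auto
  also have "\<dots> = (\<Sum>i. content_outer m (E i)) + ennreal e"
    by (subst suminf_add[symmetric]) (auto simp del: power_Suc simp: e)
  finally show "content_outer m (\<Union>i. E i) \<le> (\<Sum>i. content_outer m (E i)) + ennreal e" .
qed

lemma content_outer_empty: "content_outer m {} = 0"
proof -
  have "{K. compact K \<and> K \<subseteq> ({}::'a set)} = {{}}" by auto
  then show ?thesis by (simp add: content_outer_open open_content_def content_empty)
qed

lemma outer_measure_space_content_outer: "outer_measure_space UNIV (content_outer m)"
  unfolding outer_measure_space_def positive_def increasing_def countably_subadditive_def
  using content_outer_empty content_outer_mono content_outer_countable_subadd by auto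

text \<open>The nontrivial half of Caratheodory's condition for open sets. For open \<open>V\<close>
  around \<open>E\<close>, exhaust \<open>V \<inter> U\<close> by compact sets \<open>K\<close>;
  then \<open>V - K\<close> is open, contains \<open>E - U\<close>, and is exhausted by compact sets
  \<open>L\<close> disjoint from \<open>K\<close>. Additivity applies to
  \<open>K \<union> L\<close>, which lies in \<open>V\<close>.\<close>

lemma content_outer_split_ge:
  assumes "open U"
  shows "content_outer m (E \<inter> U) + content_outer m (E - U) \<le> content_outer m E"
  unfolding content_outer_def[of m E]
proof (rule INF_greatest, safe)
  fix V :: "'a set" assume V: "open V" "E \<subseteq> V"
  have "open_content m (V \<inter> U) + content_outer m (E - U)
      = (SUP K\<in>{K. compact K \<and> K \<subseteq> V \<inter> U}. m K + content_outer m (E - U))"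
    unfolding open_content_def by (rule ennreal_SUP_add_left[symmetric]) auto
  also have "\<dots> \<le> open_content m V"
  proof (rule SUP_least, clarify)
    fix K assume K: "compact K" "K \<subseteq> V \<inter> U"
    have "open (V - K)" using V K by (auto intro: compact_imp_closed)
    then have "m K + content_outer m (E - U) \<le> m K + open_content m (V - K)"
      using K V by (intro add_left_mono content_outer_le) auto
    also have "\<dots> = (SUP L\<in>{L. compact L \<and> L \<subseteq> V - K}. m K + m L)"
      unfolding open_content_def by (rule ennreal_SUP_add_right) auto
    also have "\<dots> \<le> open_content m V"
    proof (rule SUP_least, clarify)
      fix L assume L: "compact L" "L \<subseteq> V - K"
      have "m K + m L = m (K \<union> L)"
        using K L by (intro content_add[symmetric]) auto
      also have "\<dots> \<le> open_content m V"
        using K L by (intro content_le_open) auto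
      finally show "m K + m L \<le> open_content m V" .
    qed
    finally show "m K + content_outer m (E - U) \<le> open_content m V" .
  qed
  finally have le: "open_content m (V \<inter> U) + content_outer m (E - U) \<le> open_content m V" .
  have "content_outer m (E \<inter> U) \<le> open_content m (V \<inter> U)"
    using V assms by (intro content_outer_le) auto
  then show "content_outer m (E \<inter> U) + content_outer m (E - U) \<le> open_content m V"
    by (rule order_trans[OF add_right_mono le])
qed

lemma open_in_lambda_system:
  assumes "open U"
  shows "U \<in> lambda_system UNIV UNIV (content_outer m)"
proof -
  interpret P: sigma_algebra "UNIV :: 'a set" "UNIV :: 'a set set"
    using sigma_algebra_Pow[of "UNIV :: 'a set"] by simp
  have sa: "subadditive UNIV (content_outer m)"
    using outer_measure_space_content_outer P.countably_subadditive_subadditive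
    by (auto simp: outer_measure_space_def)
  have "content_outer m E \<le> content_outer m (E \<inter> U) + content_outer m (E - U)" for E
    using subadditiveD[OF sa, of "E \<inter> U" "E - U"] by (auto simp: Int_Diff_Un)
  then show ?thesis
    unfolding P.lambda_system_eq using content_outer_split_ge[OF assms] by (auto intro: antisym)
qed

definition content_measure :: "'a measure" where
  "content_measure = measure_of UNIV {S. open S} (content_outer m)"

lemma sets_content_measure: "sets content_measure = sets borel"
  by (simp add: content_measure_def borel_def)

text \<open>\<open>measure_of\<close> yields the zero measure when its set function is not countably
  additive, so the values need proof. Open sets satisfy Caratheodory's condition, hence so do all
  Borel sets, and the outer measure restricts to a measure on them.\<close>

lemma emeasure_content_measure:
  assumes "A \<in> sets borel"
  shows "emeasure content_measure A = content_outer m A"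
proof -
  interpret P: sigma_algebra "UNIV :: 'a set" "UNIV :: 'a set set"
    using sigma_algebra_Pow[of "UNIV :: 'a set"] by simp
  have ms: "measure_space UNIV (lambda_system UNIV UNIV (content_outer m)) (content_outer m)"
    by (rule P.caratheodory_lemma[OF outer_measure_space_content_outer])
  then have sal: "sigma_algebra UNIV (lambda_system UNIV UNIV (content_outer m))"
    by (simp add: measure_space_def)
  have sub: "sigma_sets UNIV {S::'a set. open S} \<subseteq> lambda_system UNIV UNIV (content_outer m)"
    using open_in_lambda_system by (intro sigma_algebra.sigma_sets_subset[OF sal]) auto
  have "measure_space UNIV (sigma_sets UNIV {S::'a set. open S}) (content_outer m)"
    by (rule measure_down[OF ms sigma_algebra_sigma_sets sub]) simp
  moreover have "sets content_measure = sigma_sets UNIV {S::'a set. open S}"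
    by (simp add: content_measure_def)
  ultimately show ?thesis
    using assms sets_content_measure
    by (intro emeasure_measure_of[OF content_measure_def]) (simp_all add: measure_space_def)
qed

lemma emeasure_content_measure_open:
  "open U \<Longrightarrow> emeasure content_measure U = (SUP K\<in>{K. compact K \<and> K \<subseteq> U}. m K)"
  by (simp add: emeasure_content_measure content_outer_open open_content_def)

text \<open>Equality cannot be expected: a content need not be approximable from outside on compact
  sets, and the measure corrects it upwards.\<close>

lemma content_le_content_measure:
  assumes "compact K"
  shows "m K \<le> emeasure content_measure K"
proof -
  have "m K \<le> content_outer m K"
    unfolding content_outer_def by (rule INF_greatest) (use assms content_le_open in blast)
  then show ?thesis
    using assms by (simp add: emeasure_content_measure borel_compact)
qed

lemma finite_content_measure: "finite_measure content_measure"
proof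
  have "space content_measure = UNIV"
    using sets_eq_imp_space_eq[OF sets_content_measure] by simp
  then show "emeasure content_measure (space content_measure) \<noteq> \<infinity>"
    using content_outer_finite[of UNIV] by (simp add: emeasure_content_measure)
qed

lemma content_measure_outer_regular:
  assumes "A \<in> sets borel"
  shows "emeasure content_measure A = (INF U\<in>{U. open U \<and> A \<subseteq> U}. emeasure content_measure U)"
proof -
  have "emeasure content_measure A = (INF U\<in>{U. open U \<and> A \<subseteq> U}. open_content m U)"
    unfolding emeasure_content_measure[OF assms] by (rule content_outer_def)
  also have "\<dots> = (INF U\<in>{U. open U \<and> A \<subseteq> U}. emeasure content_measure U)"
    by (rule INF_cong[OF refl]) (simp add: emeasure_content_measure content_outer_open)
  finally show ?thesis .
qed

text \<open>On an open set the measure is by construction a supremum of values of \<open>m\<close>;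
  replacing \<open>m\<close> by the larger measure on compact sets keeps the supremum below the
  measure of the open set.\<close>

lemma content_measure_inner_regular:
  assumes U: "open U"
  shows "emeasure content_measure U = (SUP K\<in>{K. compact K \<and> K \<subseteq> U}. emeasure content_measure K)"
proof (rule antisym)
  show "emeasure content_measure U \<le> (SUP K\<in>{K. compact K \<and> K \<subseteq> U}. emeasure content_measure K)"
    unfolding emeasure_content_measure_open[OF U]
    by (rule SUP_subset_mono[OF subset_refl]) (simp add: content_le_content_measure)
  show "(SUP K\<in>{K. compact K \<and> K \<subseteq> U}. emeasure content_measure K) \<le> emeasure content_measure U"
    by (rule SUP_least, rule emeasure_mono) (use U in \<open>simp_all add: sets_content_measure\<close>)
qed

lemma regular_content_measure: "regular_measure content_measure"
  unfolding regular_measure_def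
  using sets_content_measure finite_content_measure content_measure_outer_regular
    content_measure_inner_regular by blast

end

section \<open>Weak cluster points of probability measures\<close>

text \<open>Tychonoff's theorem. The index type will be the type of all subsets of the group, in
  general uncountable, so a diagonal sequence would not do.\<close>

lemma compact_unit_cube: "compact {x :: 'i \<Rightarrow> real. \<forall>i. x i \<in> {0..1}}"
proof -
  have "compactin (product_topology (\<lambda>i::'i. euclidean :: real topology) UNIV) (PiE UNIV (\<lambda>i. {0..1}))"
    by (subst compactin_PiE) (simp add: compactin_euclidean_iff)
  moreover have "PiE UNIV (\<lambda>i. {0..1}) = {x :: 'i \<Rightarrow> real. \<forall>i. x i \<in> {0..1}}"
    by (auto simp: PiE_def)
  ultimately show ?thesis
    by (simp add: euclidean_product_topology compactin_euclidean_iff)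
qed

text \<open>The filter plays the role of a subnet along which the bounded family converges.\<close>

lemma unit_cube_cluster:
  fixes X :: "nat \<Rightarrow> 'i \<Rightarrow> real"
  assumes "\<And>n i. X n i \<in> {0..1}"
  obtains G m where "G \<noteq> bot" "G \<le> sequentially" "\<And>i. ((\<lambda>n. X n i) \<longlongrightarrow> m i) G"
proof -
  have "filtermap X sequentially \<noteq> bot"
    by (simp add: filtermap_bot_iff)
  moreover have "eventually (\<lambda>x. x \<in> {x :: 'i \<Rightarrow> real. \<forall>i. x i \<in> {0..1}}) (filtermap X sequentially)"
    using assms by (simp add: eventually_filtermap)
  ultimately obtain m where m: "inf (nhds m) (filtermap X sequentially) \<noteq> bot"
    using compact_unit_cube[unfolded compact_filter] by blast
  \<comment> \<open>Pulling the neighbourhoods of the cluster point back along \<open>X\<close>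
    gives a filter of indices along which \<open>X\<close> converges; it is proper precisely because
    \<open>m\<close> is a cluster point.\<close>
  define G where "G = inf sequentially (filtercomap X (nhds m))"
  have "G \<noteq> bot"
  proof
    assume "G = bot"
    then have "eventually (\<lambda>_. False) G" by simp
    then obtain P Q where P: "eventually P sequentially" and Q: "eventually Q (filtercomap X (nhds m))"
      and PQ: "\<And>n. P n \<Longrightarrow> Q n \<Longrightarrow> False"
      unfolding G_def eventually_inf by auto
    from Q obtain R where R: "eventually R (nhds m)" "\<And>n. R (X n) \<Longrightarrow> Q n"
      unfolding eventually_filtercomap by auto
    have "eventually (\<lambda>x. \<not> R x) (filtermap X sequentially)"
      unfolding eventually_filtermap using P by eventually_elim (use PQ R in auto)
    with R(1) have "eventually (\<lambda>_. False) (inf (nhds m) (filtermap X sequentially))"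
      unfolding eventually_inf by auto
    with m show False by (simp add: eventually_False)
  qed
  moreover have "G \<le> sequentially" by (simp add: G_def)
  moreover have "((\<lambda>n. X n i) \<longlongrightarrow> m i) G" for i
  proof -
    have lim: "(X \<longlongrightarrow> m) G"
      unfolding G_def filterlim_def
      by (rule order_trans[OF filtermap_mono[OF inf_le2] filtermap_filtercomap])
    show ?thesis
    proof (rule topological_tendstoI)
      fix S :: "real set" assume S: "open S" "m i \<in> S"
      have "open ((\<lambda>x::'i \<Rightarrow> real. x i) -` S)"
        by (rule open_vimage[OF S(1) continuous_on_product_coordinates])
      then show "eventually (\<lambda>n. X n i \<in> S) G"
        using topological_tendstoD[OF lim, of "(\<lambda>x. x i) -` S"] S(2) by simp
    qed
  qed
  ultimately show thesis by (rule that)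
qed

text \<open>The sum counts the integers from 1 to \<open>N\<close> strictly below \<open>y\<close>.
  Stopping at \<open>N\<close> loses nothing beyond the error 1, as \<open>y\<close> is at most
  \<open>N + 1\<close>.\<close>

lemma sum_level_indicators_bounds:
  fixes y :: real
  assumes "0 \<le> y" "y \<le> real N + 1"
  shows "(\<Sum>i=1..N. of_bool (real i < y)) \<le> y" "y - 1 \<le> (\<Sum>i=1..N. of_bool (real i < y))"
proof -
  have le: "(\<Sum>i=1..N. of_bool (real i < y)) \<le> real N" for N
    by (rule order_trans[OF sum_mono[where g="\<lambda>_. 1"]]) auto
  show "(\<Sum>i=1..N. of_bool (real i < y)) \<le> y"
  proof (induction N)
    case (Suc N)
    then show ?case
      using le[of "Suc N"] by (cases "real (Suc N) < y") auto
  qed (use assms in simp)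
  show "y - 1 \<le> (\<Sum>i=1..N. of_bool (real i < y))"
    using assms(2)
  proof (induction N)
    case (Suc N)
    show ?case
    proof (cases "y \<le> real N + 1")
      case True
      then show ?thesis using Suc.IH by simp
    next
      case False
      have "(\<Sum>i=1..Suc N. of_bool (real i < y)) = (\<Sum>i=1..Suc N. 1::real)"
        by (rule sum.cong) (use False in auto)
      then show ?thesis using Suc.prems by simp
    qed
  qed simp
qed

text \<open>A discrete layer cake formula: \<open>f\<close> lies within \<open>1 / N\<close> above
  the average \<open>s\<close> of the indicators of its superlevel sets. It turns convergence of set
  values into convergence of integrals.\<close>

lemma level_sum_integral_bounds:
  fixes f :: "'a::topological_space \<Rightarrow> real"
  assumes M: "prob_space M" "sets M = sets borel"
    and f: "continuous_on UNIV f" "\<And>x. 0 \<le> f x" "\<And>x. f x \<le> 1" and "N > 0"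
  shows "(\<Sum>i=1..N. measure M {x. real i / real N < f x}) / N \<le> (\<integral>x. f x \<partial>M)"
    and "(\<integral>x. f x \<partial>M) \<le> (\<Sum>i=1..N. measure M {x. real i / real N < f x}) / N + 1 / N"
proof -
  interpret prob_space M by fact
  have fm: "f \<in> borel_measurable M"
    using borel_measurable_continuous_onI[OF f(1)] M(2) measurable_cong_sets by blast
  have sp: "space M = UNIV" using M(2) sets_eq_imp_space_eq by fastforce
  have U: "{x. real i / real N < f x} \<in> sets M" for i
    using fm unfolding borel_measurable_iff_greater sp by auto
  have fi: "integrable M f"
    by (rule integrable_const_bound[where B=1]) (use f fm in auto)
  define s where "s x = (\<Sum>i=1..N. indicat_real {x. real i / real N < f x} x) / N" for x
  have Ui: "integrable M (indicat_real {x. real i / real N < f x})" for i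
    using U by (simp add: emeasure_eq_measure)
  then have si: "integrable M s"
    unfolding s_def by (intro integrable_divide Bochner_Integration.integrable_sum) auto
  have sint: "(\<integral>x. s x \<partial>M) = (\<Sum>i=1..N. measure M {x. real i / real N < f x}) / N"
    unfolding s_def using Ui by (subst integral_divide_zero, subst Bochner_Integration.integral_sum) (auto simp: sp)
  have sf: "s x \<le> f x" "f x \<le> s x + 1 / N" for x
  proof -
    have eq: "s x = (\<Sum>i=1..N. of_bool (real i < real N * f x)) / N"
      unfolding s_def using \<open>N > 0\<close>
      by (intro arg_cong[where f="\<lambda>t. t / real N"] sum.cong) (auto simp: indicator_def field_simps)
    have "real N * f x \<le> real N + 1"
      using f(3)[of x] mult_left_le[of "f x" "real N"] by simp
    from sum_level_indicators_bounds[OF _ this] f(2)[of x] \<open>N > 0\<close>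
    show "s x \<le> f x" "f x \<le> s x + 1 / N"
      unfolding eq by (auto simp: field_simps)
  qed
  show "(\<Sum>i=1..N. measure M {x. real i / real N < f x}) / N \<le> (\<integral>x. f x \<partial>M)"
    unfolding sint[symmetric] using sf si fi by (intro integral_mono) auto
  have "(\<integral>x. f x \<partial>M) \<le> (\<integral>x. s x + 1 / N \<partial>M)"
    using sf si fi by (intro integral_mono) auto
  also have "\<dots> = (\<integral>x. s x \<partial>M) + 1 / N"
    using si by (simp add: prob_space)
  finally show "(\<integral>x. f x \<partial>M) \<le> (\<Sum>i=1..N. measure M {x. real i / real N < f x}) / N + 1 / N"
    unfolding sint .
qed


text \<open>The pointwise limit \<open>m\<close> of the set functions is only finitely additive on
  Borel sets. The measure \<open>\<nu>\<close> induced by it satisfies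
  \<open>\<nu> U \<le> m U\<close> on open sets and \<open>m K \<le> \<nu> K\<close> on compact
  sets, and these two bounds suffice for integrals of continuous functions.\<close>

lemma prob_weak_cluster_point:
  fixes M :: "nat \<Rightarrow> 'a::t2_space measure"
  assumes compact: "compact (UNIV :: 'a set)"
    and prob: "\<And>n. prob_space (M n)" and sets: "\<And>n. sets (M n) = sets borel"
  obtains G \<nu> where "G \<noteq> bot" "G \<le> sequentially" "regular_measure \<nu>" "prob_space \<nu>"
    "\<And>f :: 'a \<Rightarrow> real. continuous_on UNIV f \<Longrightarrow> ((\<lambda>n. \<integral>x. f x \<partial>M n) \<longlongrightarrow> (\<integral>x. f x \<partial>\<nu>)) G"
proof -
  interpret M: prob_space "M n" for n by (rule prob)
  have "measure (M n) A \<in> {0..1}" for n A by simp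
  then obtain G m where G: "G \<noteq> bot" "G \<le> sequentially"
    and m: "\<And>A. ((\<lambda>n. measure (M n) A) \<longlongrightarrow> m A) G"
    by (rule unit_cube_cluster[of "\<lambda>n. measure (M n)"]) blast
  have m_nonneg: "0 \<le> m A" for A
    by (rule tendsto_lowerbound[OF m _ G(1)]) simp
  have m_empty: "m {} = 0"
    using tendsto_unique[OF G(1) m[of "{}"], of 0] by simp
  have sp: "space (M n) = UNIV" for n using sets sets_eq_imp_space_eq by fastforce
  have m_UNIV: "m UNIV = 1"
  proof -
    have "measure (M n) UNIV = 1" for n using M.prob_space[of n] sp by simp
    then show ?thesis using tendsto_unique[OF G(1) m[of UNIV], of 1] by simp
  qed
  have m_mono: "m A \<le> m B" if "A \<subseteq> B" "A \<in> sets borel" "B \<in> sets borel" for A B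
    by (rule tendsto_le[OF G(1) m m]) (use that sets in \<open>auto intro!: M.finite_measure_mono always_eventually\<close>)
  have m_add: "m (A \<union> B) = m A + m B" if "A \<inter> B = {}" "A \<in> sets borel" "B \<in> sets borel" for A B
  proof -
    have "measure (M n) (A \<union> B) = measure (M n) A + measure (M n) B" for n
      using that sets by (intro M.finite_measure_Union) auto
    then show ?thesis
      using tendsto_unique[OF G(1) m[of "A \<union> B"]] tendsto_add[OF m[of A] m[of B]] by simp
  qed
  have m_subadd: "m (A \<union> B) \<le> m A + m B" if "A \<in> sets borel" "B \<in> sets borel" for A B
  proof -
    have "m (A \<union> B) = m A + m (B - A)"
      using m_add[of A "B - A"] that by simp
    then show ?thesis using m_mono[of "B - A" B] that by auto
  qed
  interpret c: compact_content "\<lambda>A. ennreal (m A)"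
    by unfold_locales
      (use compact m_mono m_subadd m_add in
        \<open>auto simp: m_empty m_nonneg borel_compact ennreal_plus[symmetric] intro!: ennreal_leI simp del: ennreal_plus\<close>)
  define \<nu> where "\<nu> = c.content_measure"
  have reg: "regular_measure \<nu>" unfolding \<nu>_def by (rule c.regular_content_measure)
  have sets_\<nu>: "sets \<nu> = sets borel" unfolding \<nu>_def by (rule c.sets_content_measure)
  then have sp_\<nu>: "space \<nu> = UNIV" using sets_eq_imp_space_eq by fastforce
  have "emeasure \<nu> UNIV = 1"
  proof (rule antisym)
    show "emeasure \<nu> UNIV \<le> 1"
      unfolding \<nu>_def c.emeasure_content_measure_open[OF open_UNIV]
      by (rule SUP_least) (use m_mono[of _ UNIV] in \<open>auto simp: m_UNIV borel_compact\<close>)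
    show "1 \<le> emeasure \<nu> UNIV"
      using c.content_le_content_measure[OF compact] by (simp add: \<nu>_def m_UNIV)
  qed
  then interpret \<nu>: prob_space \<nu> by (intro prob_spaceI) (simp add: sp_\<nu>)
  have open_le: "measure \<nu> U \<le> m U" if "open U" for U
  proof -
    have "emeasure \<nu> U \<le> ennreal (m U)"
      unfolding \<nu>_def c.emeasure_content_measure_open[OF that]
      by (rule SUP_least) (use m_mono that in \<open>auto simp: borel_compact intro!: ennreal_leI\<close>)
    then show ?thesis by (simp add: \<nu>.emeasure_eq_measure m_nonneg)
  qed
  have compact_ge: "m K \<le> measure \<nu> K" if "compact K" for K
    using c.content_le_content_measure[OF that]
    by (simp add: \<nu>_def[symmetric] \<nu>.emeasure_eq_measure)
  have lim01: "((\<lambda>n. \<integral>x. f x \<partial>M n) \<longlongrightarrow> (\<integral>x. f x \<partial>\<nu>)) G"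
    if f: "continuous_on UNIV f" "\<And>x. 0 \<le> f x" "\<And>x. f x \<le> 1" for f :: "'a \<Rightarrow> real"
  proof (rule tendstoI)
    fix e :: real assume "0 < e"
    \<comment> \<open>Three errors of size \<open>1 / N\<close> add up: discretising the integral,
      comparing \<open>m\<close> with \<open>\<nu>\<close>, and approaching the limit along
      \<open>G\<close>.\<close>
    obtain N where N: "N > 0" "3 / real N < e"
    proof -
      obtain N where "3 / e < real N" using reals_Archimedean2 by blast
      moreover have "0 < 3 / e" using \<open>0 < e\<close> by simp
      ultimately have "0 < real N" "3 / e < real N" by linarith+
      with \<open>0 < e\<close> show ?thesis
        by (intro that[of N]) (simp_all add: pos_divide_less_eq mult.commute[of e])
    qed
    define U where "U i = {x. real i / real N < f x}" for i
    have U_open: "open (U i)" for i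
      unfolding U_def by (intro open_Collect_less continuous_on_const f(1))
    define A where "A = (\<Sum>i=1..N. m (U i)) / N"
    define B where "B = (\<Sum>i=1..N. measure \<nu> (U i)) / N"
    have "B \<le> A"
      unfolding A_def B_def by (intro divide_right_mono sum_mono open_le U_open) simp
    \<comment> \<open>For open sets \<open>m\<close> may exceed \<open>\<nu>\<close>. The closed
      superlevel set \<open>K\<close> lies between two consecutive open ones, so a shift of the
      level by one step reverses the inequality.\<close>
    have "m (U i) \<le> measure \<nu> (U (i - 1))" if "i \<in> {1..N}" for i
    proof -
      define K where "K = {x. real i / real N \<le> f x}"
      have cl: "closed K"
        unfolding K_def by (intro closed_Collect_le continuous_on_const f(1))
      then have K: "compact K" using compact_Int_closed[OF compact cl] by simp
      have "m (U i) \<le> m K"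
        using U_open cl by (intro m_mono) (auto simp: U_def K_def)
      also have "\<dots> \<le> measure \<nu> K" by (rule compact_ge[OF K])
      also have "\<dots> \<le> measure \<nu> (U (i - 1))"
      proof (rule \<nu>.finite_measure_mono)
        have "real (i - 1) / real N < real i / real N"
          using that \<open>N > 0\<close> by (intro divide_strict_right_mono) auto
        then show "K \<subseteq> U (i - 1)" by (auto simp: K_def U_def)
      qed (use U_open sets_\<nu> in auto)
      finally show ?thesis .
    qed
    then have "(\<Sum>i=1..N. m (U i)) \<le> (\<Sum>i=1..N. measure \<nu> (U (i - 1)))"
      by (rule sum_mono)
    also have "\<dots> = (\<Sum>i<N. measure \<nu> (U i))"
      by (rule sum.reindex_bij_witness[of _ Suc "\<lambda>i. i - 1"]) auto
    also have "\<dots> \<le> (\<Sum>i<Suc N. measure \<nu> (U i))" by simp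
    also have "\<dots> = measure \<nu> (U 0) + (\<Sum>i<N. measure \<nu> (U (Suc i)))"
      by (rule sum.lessThan_Suc_shift)
    also have "(\<Sum>i<N. measure \<nu> (U (Suc i))) = (\<Sum>i=1..N. measure \<nu> (U i))"
      by (rule sum.reindex_bij_witness[of _ "\<lambda>i. i - 1" Suc]) auto
    \<comment> \<open>The shift costs only the additional term for \<open>U 0\<close>, which is at
      most 1 and contributes \<open>1 / N\<close> after averaging.\<close>
    finally have "(\<Sum>i=1..N. m (U i)) \<le> 1 + (\<Sum>i=1..N. measure \<nu> (U i))"
      using \<nu>.prob_le_1[of "U 0"] by linarith
    then have "A \<le> B + 1 / N"
      unfolding A_def B_def add_divide_distrib[symmetric] by (intro divide_right_mono) simp_all
    have \<nu>b: "B \<le> (\<integral>x. f x \<partial>\<nu>)" "(\<integral>x. f x \<partial>\<nu>) \<le> B + 1 / N"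
      using level_sum_integral_bounds[OF \<nu>.prob_space_axioms sets_\<nu> f \<open>N > 0\<close>]
      by (simp_all add: B_def U_def)
    have "((\<lambda>n. (\<Sum>i=1..N. measure (M n) (U i)) / N) \<longlongrightarrow> A) G"
      unfolding A_def divide_inverse by (intro tendsto_intros m)
    then have "eventually (\<lambda>n. dist ((\<Sum>i=1..N. measure (M n) (U i)) / N) A < 1 / N) G"
      using \<open>N > 0\<close> by (intro tendstoD) auto
    then show "eventually (\<lambda>n. dist (\<integral>x. f x \<partial>M n) (\<integral>x. f x \<partial>\<nu>) < e) G"
    proof eventually_elim
      case (elim n)
      have "(\<Sum>i=1..N. measure (M n) (U i)) / N \<le> (\<integral>x. f x \<partial>M n)"
        "(\<integral>x. f x \<partial>M n) \<le> (\<Sum>i=1..N. measure (M n) (U i)) / N + 1 / N"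
        using level_sum_integral_bounds[OF prob sets f \<open>N > 0\<close>] by (simp_all add: U_def)
      with elim \<nu>b \<open>B \<le> A\<close> \<open>A \<le> B + 1 / N\<close> N(2) show ?case
        unfolding dist_real_def by linarith
    qed
  qed
  have "((\<lambda>n. \<integral>x. f x \<partial>M n) \<longlongrightarrow> (\<integral>x. f x \<partial>\<nu>)) G"
    if f: "continuous_on UNIV f" for f :: "'a \<Rightarrow> real"
  proof -
    have "bounded (range f)"
      using compact f by (intro compact_imp_bounded compact_continuous_image)
    then obtain b where b: "b > 0" "\<And>x. \<bar>f x\<bar> \<le> b"
      unfolding bounded_pos by auto
    define g where "g x = (f x + b) / (2 * b)" for x
    have fg: "f x = 2 * b * g x - b" for x using b(1) by (simp add: g_def)
    have f_le: "- b \<le> f x" "f x \<le> b" for x using b(2)[of x] by linarith+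
    have g: "continuous_on UNIV g" "\<And>x. 0 \<le> g x" "\<And>x. g x \<le> 1"
    proof -
      show "continuous_on UNIV g"
        unfolding g_def divide_inverse by (intro continuous_intros f)
      show "0 \<le> g x" for x
        unfolding g_def using f_le[of x] b(1) by (intro divide_nonneg_pos) linarith+
      show "g x \<le> 1" for x
        unfolding g_def using f_le[of x] b(1) by (subst divide_le_eq_1_pos) linarith+
    qed
    have int: "(\<integral>x. f x \<partial>N) = 2 * b * (\<integral>x. g x \<partial>N) - b" if "prob_space N" "sets N = sets borel" for N
    proof -
      interpret N: prob_space N by fact
      have "g \<in> borel_measurable N"
        using borel_measurable_continuous_onI[OF g(1)] that(2) measurable_cong_sets by blast
      then have "integrable N g"
        by (rule N.integrable_const_bound[where B=1, rotated]) (use g in auto)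
      then show ?thesis unfolding fg by (simp add: N.prob_space)
    qed
    show ?thesis
      unfolding int[OF prob sets] int[OF \<nu>.prob_space_axioms sets_\<nu>]
      by (intro tendsto_intros lim01 g)
  qed
  then show thesis
    by (rule that[OF G reg \<nu>.prob_space_axioms])
qed

section \<open>Fejer kernels\<close>

text \<open>Cesaro mean of the partial sums of the series of \<open>1 / (1 - z)\<close>: the
  coefficient of \<open>z ^ k\<close> is \<open>1 - k / N\<close> for \<open>k < N\<close>. It is
  the analytic half of the Fejer kernel.\<close>

definition geometric_mean_sum :: "nat \<Rightarrow> complex \<Rightarrow> complex" where
  "geometric_mean_sum N z = (\<Sum>j=1..N. \<Sum>k<j. z ^ k) / N"

text \<open>On the unit circle this is the usual Fejer kernel, with weight
  \<open>1 - |k| / N\<close> on the power \<open>k\<close> of either sign. For \<open>N = 0\<close>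
  the division by zero makes it -1, whence the hypothesis \<open>N > 0\<close> in the positivity
  results.\<close>

definition fejer :: "nat \<Rightarrow> complex \<Rightarrow> real" where
  "fejer N z = 2 * Re (geometric_mean_sum N z) - 1"

text \<open>In the step from \<open>N\<close> to \<open>Suc N\<close> the cross term is the
  conjugate of the new partial sum without its constant term 1. The squares therefore grow by
  \<open>2 * Re (\<Sum>k<Suc N. z ^ k) - 1\<close>, a Dirichlet kernel; dividing the total by
  \<open>N\<close> exhibits the Fejer kernel as nonnegative.\<close>

lemma cmod_geometric_sum_sq:
  assumes "cmod z = 1"
  shows "(cmod (\<Sum>k<N. z ^ k))\<^sup>2 = (\<Sum>j=1..N. 2 * Re (\<Sum>k<j. z ^ k) - 1)"
proof (induction N)
  case (Suc N)
  have zz: "z * cnj z = 1" using assms by (simp add: complex_norm_square[symmetric])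
  have "(\<Sum>k<N. z ^ k) * cnj (z ^ N) = (\<Sum>k<N. cnj z ^ (N - k))"
    unfolding sum_distrib_right
  proof (rule sum.cong[OF refl])
    fix k assume "k \<in> {..<N}"
    then have "cnj z ^ N = cnj z ^ k * cnj z ^ (N - k)" by (simp add: power_add[symmetric])
    then have "z ^ k * cnj (z ^ N) = (z * cnj z) ^ k * cnj z ^ (N - k)"
      by (simp add: power_mult_distrib)
    then show "z ^ k * cnj (z ^ N) = cnj z ^ (N - k)" by (simp add: zz)
  qed
  also have "\<dots> = (\<Sum>k<N. cnj z ^ Suc k)"
    by (rule sum.reindex_bij_witness[of _ "\<lambda>k. N - Suc k" "\<lambda>k. N - Suc k"]) (auto simp: Suc_diff_Suc)
  also have "\<dots> = cnj (\<Sum>k<Suc N. z ^ k) - 1"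
    unfolding sum.lessThan_Suc_shift[of _ N] by simp
  finally have cross: "(\<Sum>k<N. z ^ k) * cnj (z ^ N) = cnj (\<Sum>k<Suc N. z ^ k) - 1" .
  have sq_add: "(cmod (a + b))\<^sup>2 = (cmod a)\<^sup>2 + (cmod b)\<^sup>2 + 2 * Re (a * cnj b)" for a b
    unfolding cmod_power2 by (simp add: power2_eq_square algebra_simps)
  have "(cmod (\<Sum>k<Suc N. z ^ k))\<^sup>2 = (cmod (\<Sum>k<N. z ^ k))\<^sup>2 + (cmod (z ^ N))\<^sup>2
      + 2 * Re ((\<Sum>k<N. z ^ k) * cnj (z ^ N))"
    unfolding sum.lessThan_Suc by (rule sq_add)
  also have "\<dots> = (cmod (\<Sum>k<N. z ^ k))\<^sup>2 + (2 * Re (\<Sum>k<Suc N. z ^ k) - 1)"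
  proof -
    have re: "Re (cnj w - 1) = Re w - 1" for w by simp
    have "(cmod (z ^ N))\<^sup>2 = 1" using assms by (simp add: norm_power)
    moreover have "a + 1 + 2 * (r - 1) = a + (2 * r - 1)" for a r :: real by simp
    ultimately show ?thesis unfolding cross re by (simp only:)
  qed
  finally show ?case using Suc.IH by simp
qed simp

lemma fejer_eq:
  assumes "cmod z = 1" "N > 0"
  shows "fejer N z = (cmod (\<Sum>k<N. z ^ k))\<^sup>2 / N"
proof -
  have "(cmod (\<Sum>k<N. z ^ k))\<^sup>2 = 2 * Re (\<Sum>j=1..N. \<Sum>k<j. z ^ k) - N"
    unfolding cmod_geometric_sum_sq[OF assms(1)] by (simp add: sum_subtractf sum_distrib_left)
  then show ?thesis
    using assms(2) by (simp add: fejer_def geometric_mean_sum_def field_simps)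
qed

lemma fejer_nonneg: "cmod z = 1 \<Longrightarrow> N > 0 \<Longrightarrow> 0 \<le> fejer N z"
  by (simp add: fejer_eq)

text \<open>The factor \<open>1 - z\<close> telescopes the geometric sum to
  \<open>1 - z ^ N\<close>, of modulus at most 2. This measures how the kernel concentrates at
  \<open>z = 1\<close>.\<close>

lemma fejer_times_sq_le:
  assumes "cmod z = 1" "N > 0"
  shows "fejer N z * (cmod (1 - z))\<^sup>2 \<le> 4 / N"
proof -
  have "cmod (1 - z ^ N) \<le> 2"
    using norm_triangle_ineq4[of 1 "z ^ N"] assms by (simp add: norm_power)
  then have "(cmod (1 - z ^ N))\<^sup>2 \<le> 2\<^sup>2"
    by (intro power_mono) auto
  moreover have "fejer N z * (cmod (1 - z))\<^sup>2 = (cmod (1 - z ^ N))\<^sup>2 / N"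
    unfolding fejer_eq[OF assms] one_diff_power_eq[of z N]
    by (simp add: norm_mult power_mult_distrib)
  ultimately show ?thesis by (simp add: divide_right_mono)
qed

text \<open>The partial sums stay bounded by \<open>2 / cmod (1 - z)\<close>, so division by their
  length sends them to 0.\<close>

lemma geometric_sum_mean_tendsto_0:
  assumes "cmod z \<le> 1" "z \<noteq> 1"
  shows "(\<lambda>n. (\<Sum>k<Suc n. z ^ k) / of_nat (Suc n)) \<longlonglongrightarrow> 0"
proof (rule Lim_null_comparison)
  show "(\<lambda>n. 2 / cmod (1 - z) * inverse (real (Suc n))) \<longlonglongrightarrow> 0"
    by (intro tendsto_mult_right_zero LIMSEQ_inverse_real_of_nat)
  have "cmod ((\<Sum>k<Suc n. z ^ k) / of_nat (Suc n)) \<le> 2 / cmod (1 - z) * inverse (real (Suc n))" for n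
  proof -
    have "(\<Sum>k<Suc n. z ^ k) = (1 - z ^ Suc n) / (1 - z)"
      using one_diff_power_eq[of z "Suc n"] assms(2) by (simp add: field_simps del: power_Suc sum.lessThan_Suc)
    then have "cmod ((\<Sum>k<Suc n. z ^ k) / of_nat (Suc n))
        = cmod (1 - z ^ Suc n) * inverse (cmod (1 - z)) * inverse (real (Suc n))"
      by (simp only: norm_mult norm_divide norm_of_nat divide_inverse norm_inverse)
    moreover have "cmod (1 - z ^ Suc n) \<le> 2"
    proof -
      have "cmod (z ^ Suc n) \<le> 1" unfolding norm_power by (rule power_le_one[OF norm_ge_zero assms(1)])
      then show ?thesis using norm_triangle_ineq4[of 1 "z ^ Suc n"] by simp
    qed
    ultimately show ?thesis
      by (simp only: divide_inverse) (intro mult_right_mono; simp)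
  qed
  then show "eventually (\<lambda>n. cmod ((\<Sum>k<Suc n. z ^ k) / of_nat (Suc n)) \<le> 2 / cmod (1 - z) * inverse (real (Suc n))) sequentially"
    by simp
qed

text \<open>On the unit circle the partial sums oscillate around \<open>1 / (1 - z)\<close> by
  \<open>z ^ j / (1 - z)\<close>; averaging removes the oscillation by the preceding lemma.\<close>

lemma geometric_mean_sum_tendsto:
  assumes "cmod z \<le> 1" "z \<noteq> 1"
  shows "(\<lambda>n. geometric_mean_sum (Suc n) z) \<longlonglongrightarrow> 1 / (1 - z)"
proof -
  have "geometric_mean_sum (Suc n) z = 1 / (1 - z) - z / (1 - z) * ((\<Sum>k<Suc n. z ^ k) / of_nat (Suc n))" for n
  proof -
    have D: "(\<Sum>k<j. z ^ k) = 1 / (1 - z) - z ^ j / (1 - z)" for j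
      using one_diff_power_eq[of z j] assms(2) by (simp add: field_simps)
    have "(\<Sum>j=1..Suc n. \<Sum>k<j. z ^ k) = of_nat (Suc n) * (1 / (1 - z)) - (\<Sum>j=1..Suc n. z ^ j) / (1 - z)"
      unfolding D sum_subtractf sum_divide_distrib[symmetric] by simp
    also have "(\<Sum>j=1..Suc n. z ^ j) = z * (\<Sum>k<Suc n. z ^ k)"
      unfolding sum_distrib_left
      by (rule sum.reindex_bij_witness[of _ Suc "\<lambda>i. i - 1"]) (auto simp: power_eq_if)
    finally show ?thesis
      unfolding geometric_mean_sum_def
      by (simp add: diff_divide_distrib del: sum.lessThan_Suc of_nat_Suc sum.cl_ivl_Suc)
  qed
  moreover have "(\<lambda>n. 1 / (1 - z) - z / (1 - z) * ((\<Sum>k<Suc n. z ^ k) / of_nat (Suc n))) \<longlonglongrightarrow> 1 / (1 - z) - z / (1 - z) * 0"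
    by (intro tendsto_intros geometric_sum_mean_tendsto_0 assms)
  ultimately show ?thesis by simp
qed

lemma continuous_on_geometric_mean_sum [continuous_intros]:
  "continuous_on A f \<Longrightarrow> continuous_on A (\<lambda>x. geometric_mean_sum N (f x))"
  unfolding geometric_mean_sum_def divide_inverse by (intro continuous_intros)

lemma continuous_on_fejer [continuous_intros]:
  "continuous_on A f \<Longrightarrow> continuous_on A (\<lambda>x. fejer N (f x))"
  unfolding fejer_def by (intro continuous_intros)

text \<open>Analytic plus antianalytic part; the subtracted 1 is the constant term, which both
  contain.\<close>

lemma complex_fejer:
  "complex_of_real (fejer N z) = geometric_mean_sum N z + geometric_mean_sum N (cnj z) - 1"
proof -
  have "geometric_mean_sum N (cnj z) = cnj (geometric_mean_sum N z)"
    by (simp add: geometric_mean_sum_def)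
  then show ?thesis by (simp add: fejer_def complex_eq_iff)
qed

section \<open>Characters and Haar measure\<close>

lemma characters_mult:
  "\<xi> \<in> characters \<Longrightarrow> \<eta> \<in> characters \<Longrightarrow> (\<lambda>x. \<xi> x * \<eta> x) \<in> characters"
  by (auto simp: characters_def norm_mult intro!: continuous_intros)

lemma characters_cnj: "\<xi> \<in> characters \<Longrightarrow> (\<lambda>x. cnj (\<xi> x)) \<in> characters"
  by (auto simp: characters_def intro!: continuous_intros)

lemma characters_power: "\<xi> \<in> characters \<Longrightarrow> (\<lambda>x. \<xi> x ^ k) \<in> characters"
  by (auto simp: characters_def norm_power power_mult_distrib intro!: continuous_intros)

lemma characters_continuous: "\<xi> \<in> characters \<Longrightarrow> continuous_on UNIV \<xi>"
  by (simp add: characters_def)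

lemma characters_cmod: "\<xi> \<in> characters \<Longrightarrow> cmod (\<xi> x) = 1"
  by (simp add: characters_def)

lemma characters_mult_cnj: "\<xi> \<in> characters \<Longrightarrow> \<xi> x * cnj (\<xi> x) = 1"
  by (simp add: complex_norm_square[symmetric] characters_cmod)

text \<open>Connectedness enters here: a trivial power confines the range to finitely many roots of
  unity, so the character is constant, and a constant \<open>c\<close> with \<open>c = c * c\<close>
  and modulus 1 is 1. Later lemmas receive this as the hypothesis \<open>free\<close>.\<close>

lemma character_power_nontrivial:
  fixes \<xi> :: "'a::topological_ab_group_add \<Rightarrow> complex"
  assumes "connected (UNIV :: 'a set)" and \<xi>: "\<xi> \<in> characters" "\<xi> \<noteq> (\<lambda>x. 1)" and "k > 0"
  shows "(\<lambda>x. \<xi> x ^ k) \<noteq> (\<lambda>x. 1)"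
proof
  assume eq: "(\<lambda>x. \<xi> x ^ k) = (\<lambda>x. 1)"
  then have "range \<xi> \<subseteq> {z. z ^ k = 1}" by (auto dest: fun_cong)
  then have "finite (range \<xi>)"
    using finite_roots_unity[of k, where 'a=complex] \<open>k > 0\<close> by (auto intro: finite_subset)
  moreover have "connected (range \<xi>)"
    using assms by (intro connected_continuous_image characters_continuous)
  ultimately obtain c where c: "range \<xi> = {c}"
    using connected_finite_iff_sing[of "range \<xi>"] by auto
  then have const: "\<xi> x = c" for x by auto
  have "c = c * c" "cmod c = 1"
    using \<xi>(1) const by (auto simp: characters_def)
  then have "c = 1" by auto
  with const have "\<xi> = (\<lambda>x. 1)" by auto
  with \<xi>(2) show False by simp
qed

section \<open>Integration of continuous functions against Haar measure\<close>

locale compact_haar =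
  fixes \<mu> :: "'a::{topological_ab_group_add, t2_space} measure"
  assumes compact_group: "compact (UNIV :: 'a set)" and haar: "haar_prob \<mu>"
begin

lemma sets_haar: "sets \<mu> = sets borel"
  using haar by (simp add: haar_prob_def regular_measure_def)

lemma space_haar: "space \<mu> = UNIV"
  using sets_eq_imp_space_eq[OF sets_haar] by simp

sublocale prob_space \<mu>
  using haar by (intro prob_spaceI) (simp add: haar_prob_def)

lemma continuous_measurable:
  fixes f :: "'a \<Rightarrow> 'b::topological_space"
  shows "continuous_on UNIV f \<Longrightarrow> f \<in> borel_measurable \<mu>"
  using borel_measurable_continuous_onI sets_haar measurable_cong_sets by blast

lemma continuous_bounded:
  fixes f :: "'a \<Rightarrow> 'b::real_normed_vector"
  assumes "continuous_on UNIV f"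
  obtains B where "\<And>x. norm (f x) \<le> B"
proof -
  have "bounded (range f)"
    using compact_group assms by (intro compact_imp_bounded compact_continuous_image)
  then show thesis using that by (auto simp: bounded_iff)
qed

lemma continuous_integrable:
  fixes f :: "'a \<Rightarrow> 'b::{banach, second_countable_topology}"
  assumes "continuous_on UNIV f"
  shows "integrable \<mu> f"
proof -
  obtain B where "\<And>x. norm (f x) \<le> B" using continuous_bounded[OF assms] by blast
  then show ?thesis
    using continuous_measurable[OF assms] by (intro integrable_const_bound[where B=B]) auto
qed

lemma integrable_mult_continuous:
  fixes g f :: "'a \<Rightarrow> complex"
  assumes "integrable \<mu> g" "continuous_on UNIV f"
  shows "integrable \<mu> (\<lambda>x. g x * f x)"
proof -
  obtain B where B: "\<And>x. norm (f x) \<le> B" using continuous_bounded[OF assms(2)] by blast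
  show ?thesis
  proof (rule Bochner_Integration.integrable_bound)
    show "integrable \<mu> (\<lambda>x. g x * of_real B)" using assms(1) by simp
    show "(\<lambda>x. g x * f x) \<in> borel_measurable \<mu>"
      using assms continuous_measurable by (intro borel_measurable_times) auto
    have "cmod (g x * f x) \<le> cmod (g x * of_real B)" for x
      using B[of x] norm_ge_zero[of "f x"]
      by (simp add: norm_mult mult_left_mono)
    then show "AE x in \<mu>. cmod (g x * f x) \<le> cmod (g x * of_real B)" by simp
  qed
qed

lemma integral_translate:
  fixes f :: "'a \<Rightarrow> complex"
  assumes "continuous_on UNIV f"
  shows "(\<integral>x. f (a + x) \<partial>\<mu>) = (\<integral>x. f x \<partial>\<mu>)"
proof -
  have "continuous_on UNIV (\<lambda>x::'a. a + x)" by (intro continuous_intros)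
  then have t: "(\<lambda>x. a + x) \<in> measurable \<mu> borel" by (rule continuous_measurable)
  have "distr \<mu> borel (\<lambda>x. a + x) = \<mu>"
  proof (rule measure_eqI)
    fix A assume "A \<in> sets (distr \<mu> borel (\<lambda>x. a + x))"
    then have A: "A \<in> sets borel" by simp
    \<comment> \<open>\<open>haar_prob\<close> speaks of images of translations whereas
      \<open>distr\<close> takes preimages; the two are exchanged by passing from \<open>a\<close>
      to \<open>- a\<close>.\<close>
    have "(\<lambda>x. a + x) -` A = (\<lambda>x. - a + x) ` A"
    proof (rule set_eqI)
      fix x show "x \<in> (\<lambda>x. a + x) -` A \<longleftrightarrow> x \<in> (\<lambda>x. - a + x) ` A"
        by (auto intro!: image_eqI[of x _ "a + x"])
    qed
    moreover have "emeasure \<mu> ((\<lambda>x. - a + x) ` A) = emeasure \<mu> A"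
      using haar A unfolding haar_prob_def by blast
    ultimately show "emeasure (distr \<mu> borel (\<lambda>x. a + x)) A = emeasure \<mu> A"
      using A t by (simp add: emeasure_distr space_haar)
  qed (simp add: sets_haar)
  moreover have "f \<in> borel_measurable borel"
    using assms by (rule borel_measurable_continuous_onI)
  ultimately show ?thesis using integral_distr[OF t, of f] by simp
qed

text \<open>Translation by an \<open>a\<close> with \<open>\<xi> a \<noteq> 1\<close> multiplies the
  integral by \<open>\<xi> a\<close> yet leaves it unchanged.\<close>

lemma integral_character:
  assumes "\<xi> \<in> characters" "\<xi> \<noteq> (\<lambda>x. 1)"
  shows "(\<integral>x. \<xi> x \<partial>\<mu>) = 0"
proof -
  obtain a where "\<xi> a \<noteq> 1" using assms(2) by auto
  have "(\<integral>x. \<xi> x \<partial>\<mu>) = \<xi> a * (\<integral>x. \<xi> x \<partial>\<mu>)"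
  proof -
    have "(\<integral>x. \<xi> x \<partial>\<mu>) = (\<integral>x. \<xi> (a + x) \<partial>\<mu>)"
      by (rule integral_translate[OF characters_continuous[OF assms(1)], symmetric])
    also have "(\<lambda>x. \<xi> (a + x)) = (\<lambda>x. \<xi> a * \<xi> x)"
      using assms(1) by (simp add: characters_def)
    finally show ?thesis by simp
  qed
  then have "(1 - \<xi> a) * (\<integral>x. \<xi> x \<partial>\<mu>) = 0" by (simp add: algebra_simps)
  with \<open>\<xi> a \<noteq> 1\<close> show ?thesis by simp
qed

section \<open>Orthogonality relations and integrals of Fejer kernels\<close>

lemma character_orthogonality:
  assumes "\<xi> \<in> characters" "\<eta> \<in> characters" "\<xi> \<noteq> \<eta>"
  shows "(\<integral>x. \<xi> x * cnj (\<eta> x) \<partial>\<mu>) = 0"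
proof (rule integral_character)
  show "(\<lambda>x. \<xi> x * cnj (\<eta> x)) \<in> characters"
    using assms by (intro characters_mult characters_cnj)
  show "(\<lambda>x. \<xi> x * cnj (\<eta> x)) \<noteq> (\<lambda>x. 1)"
  proof
    assume eq: "(\<lambda>x. \<xi> x * cnj (\<eta> x)) = (\<lambda>x. 1)"
    have "\<xi> x = \<eta> x" for x
    proof -
      have "\<xi> x = \<xi> x * (\<eta> x * cnj (\<eta> x))" by (simp add: characters_mult_cnj assms(2))
      also have "\<dots> = \<eta> x * (\<xi> x * cnj (\<eta> x))" by (simp add: mult_ac)
      also have "\<dots> = \<eta> x" using fun_cong[OF eq, of x] by simp
      finally show ?thesis .
    qed
    with assms(3) show False by auto
  qed
qed

text \<open>Each of the \<open>N\<close> partial sums keeps only its term for \<open>k = 0\<close>.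
  A general integrable \<open>g\<close> lets the lemma serve for the constant 1, for characters and
  for conjugates of elements of \<open>H_space\<close>.\<close>

lemma integral_geometric_mean_sum:
  assumes g: "integrable \<mu> g" and \<eta>: "\<eta> \<in> characters" and "N > 0"
    and zero: "\<And>k. k > 0 \<Longrightarrow> (\<integral>x. g x * \<eta> x ^ k \<partial>\<mu>) = 0"
  shows "(\<integral>x. g x * geometric_mean_sum N (\<eta> x) \<partial>\<mu>) = (\<integral>x. g x \<partial>\<mu>)"
proof -
  have int: "integrable \<mu> (\<lambda>x. g x * \<eta> x ^ k)" for k
    using g \<eta> by (intro integrable_mult_continuous continuous_intros characters_continuous)
  have "(\<integral>x. g x * geometric_mean_sum N (\<eta> x) \<partial>\<mu>)
      = (\<integral>x. (\<Sum>j=1..N. \<Sum>k<j. g x * \<eta> x ^ k) / N \<partial>\<mu>)"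
    by (simp add: geometric_mean_sum_def sum_distrib_left)
  also have "\<dots> = (\<Sum>j=1..N. \<Sum>k<j. (\<integral>x. g x * \<eta> x ^ k \<partial>\<mu>)) / N"
    by (simp add: int)
  also have "(\<Sum>j=1..N. \<Sum>k<j. (\<integral>x. g x * \<eta> x ^ k \<partial>\<mu>)) = (\<Sum>j=1..N. (\<integral>x. g x \<partial>\<mu>))"
  proof (rule sum.cong[OF refl])
    fix j assume "j \<in> {1..N}"
    then obtain i where j: "j = Suc i" by (cases j) auto
    show "(\<Sum>k<j. (\<integral>x. g x * \<eta> x ^ k \<partial>\<mu>)) = (\<integral>x. g x \<partial>\<mu>)"
      unfolding j sum.lessThan_Suc_shift by (simp add: zero del: power_Suc)
  qed
  finally show ?thesis using \<open>N > 0\<close> by simp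
qed

lemma integral_fejer:
  assumes \<omega>: "\<omega> \<in> characters" and free: "\<And>k. k > 0 \<Longrightarrow> (\<lambda>x. \<omega> x ^ k) \<noteq> (\<lambda>x. 1)" and "N > 0"
  shows "(\<integral>x. fejer N (\<omega> x) \<partial>\<mu>) = 1"
proof -
  have "(\<integral>x. 1 * geometric_mean_sum N (\<omega> x) \<partial>\<mu>) = (\<integral>x. 1 \<partial>\<mu>)"
    using \<omega> free \<open>N > 0\<close>
    by (intro integral_geometric_mean_sum) (auto intro!: integral_character characters_power)
  then have s: "(\<integral>x. geometric_mean_sum N (\<omega> x) \<partial>\<mu>) = 1" by (simp add: prob_space)
  have i: "integrable \<mu> (\<lambda>x. geometric_mean_sum N (\<omega> x))"
    using \<omega> by (intro continuous_integrable continuous_intros characters_continuous)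
  show ?thesis
    unfolding fejer_def using i s by (simp add: prob_space)
qed

lemma integral_character_fejer:
  assumes \<omega>: "\<omega> \<in> characters" and \<xi>: "\<xi> \<in> characters" and "N > 0"
    and ne: "\<And>k. \<xi> \<noteq> (\<lambda>x. \<omega> x ^ k)" "\<And>k. \<xi> \<noteq> (\<lambda>x. cnj (\<omega> x) ^ k)"
  shows "(\<integral>x. \<xi> x * complex_of_real (fejer N (\<omega> x)) \<partial>\<mu>) = 0"
proof -
  note c = characters_continuous[OF \<omega>] characters_continuous[OF \<xi>]
  have \<xi>0: "(\<integral>x. \<xi> x \<partial>\<mu>) = 0"
    using ne(1)[of 0] \<xi> by (intro integral_character) auto
  \<comment> \<open>Integrating against \<open>\<omega> x ^ k\<close> is the inner product with its
    conjugate, hence the crossed use of the two parts of \<open>ne\<close>.\<close>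
  have 1: "(\<integral>x. \<xi> x * \<omega> x ^ k \<partial>\<mu>) = 0" for k
    using character_orthogonality[OF \<xi> characters_power[OF characters_cnj[OF \<omega>]] ne(2), of k] by simp
  have 2: "(\<integral>x. \<xi> x * cnj (\<omega> x) ^ k \<partial>\<mu>) = 0" for k
    using character_orthogonality[OF \<xi> characters_power[OF \<omega>] ne(1), of k] by simp
  have i: "integrable \<mu> \<xi>" "integrable \<mu> (\<lambda>x. \<xi> x * geometric_mean_sum N (\<omega> x))"
      "integrable \<mu> (\<lambda>x. \<xi> x * geometric_mean_sum N (cnj (\<omega> x)))"
    by (intro continuous_integrable continuous_intros c)+
  have "(\<integral>x. \<xi> x * complex_of_real (fejer N (\<omega> x)) \<partial>\<mu>)
    = (\<integral>x. \<xi> x * geometric_mean_sum N (\<omega> x) + \<xi> x * geometric_mean_sum N (cnj (\<omega> x)) - \<xi> x \<partial>\<mu>)"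
    unfolding complex_fejer by (simp add: algebra_simps)
  also have "\<dots> = (\<integral>x. \<xi> x * geometric_mean_sum N (\<omega> x) \<partial>\<mu>)
      + (\<integral>x. \<xi> x * geometric_mean_sum N (cnj (\<omega> x)) \<partial>\<mu>) - (\<integral>x. \<xi> x \<partial>\<mu>)"
    using i by simp
  also have "\<dots> = 0"
    using integral_geometric_mean_sum[OF i(1) \<omega> \<open>N > 0\<close> 1]
      integral_geometric_mean_sum[OF i(1) characters_cnj[OF \<omega>] \<open>N > 0\<close> 2] \<xi>0 by simp
  finally show ?thesis .
qed

section \<open>Averages of the powers of a character\<close>

lemma geometric_sum_mean_cmod_le:
  assumes "\<eta> \<in> characters"
  shows "cmod ((\<Sum>k<Suc n. \<eta> x ^ k) / of_nat (Suc n)) \<le> 1"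
proof -
  have "cmod (\<Sum>k<Suc n. \<eta> x ^ k) \<le> (\<Sum>k<Suc n. 1)"
    by (rule sum_norm_le) (simp add: norm_power characters_cmod[OF assms])
  then show ?thesis by (simp add: norm_divide divide_le_eq_1 del: of_nat_Suc sum.lessThan_Suc)
qed

lemma continuous_on_geometric_sum_mean:
  assumes "\<eta> \<in> characters"
  shows "continuous_on UNIV (\<lambda>x. (\<Sum>k<Suc n. \<eta> x ^ k) / of_nat (Suc n))"
  unfolding divide_inverse by (intro continuous_intros characters_continuous[OF assms])

lemma kernel_closed: "\<omega> \<in> characters \<Longrightarrow> closed {x. \<omega> x = 1}"
  by (intro closed_Collect_eq continuous_on_const characters_continuous)

text \<open>The means of the powers of the character converge pointwise to the indicator of the kernel.\<close>

lemma measure_kernel: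
  assumes \<omega>: "\<omega> \<in> characters" and free: "\<And>k. k > 0 \<Longrightarrow> (\<lambda>x. \<omega> x ^ k) \<noteq> (\<lambda>x. 1)"
  shows "measure \<mu> {x. \<omega> x = 1} = 0"
proof -
  let ?E = "\<lambda>n x. (\<Sum>k<Suc n. \<omega> x ^ k) / complex_of_nat (Suc n)"
  let ?I = "\<lambda>x. indicator {x. \<omega> x = 1} x :: complex"
  have K: "{x. \<omega> x = 1} \<in> sets \<mu>"
    using kernel_closed[OF \<omega>] by (simp add: sets_haar)
  have int: "(\<integral>x. ?E n x \<partial>\<mu>) = inverse (complex_of_nat (Suc n))" for n
  proof -
    have "integrable \<mu> (\<lambda>x. \<omega> x ^ k)" for k
      by (intro continuous_integrable continuous_intros characters_continuous[OF \<omega>])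
    moreover have "(\<integral>x. \<omega> x ^ Suc k \<partial>\<mu>) = 0" for k
      by (intro integral_character characters_power \<omega> free) simp
    ultimately have "(\<integral>x. (\<Sum>k<Suc n. \<omega> x ^ k) \<partial>\<mu>) = 1"
      by (subst Bochner_Integration.integral_sum)
        (simp_all add: sum.lessThan_Suc_shift prob_space del: power_Suc sum.lessThan_Suc)
    then show ?thesis by (simp add: divide_inverse del: sum.lessThan_Suc of_nat_Suc)
  qed
  have "(\<lambda>n. \<integral>x. ?E n x \<partial>\<mu>) \<longlonglongrightarrow> (\<integral>x. ?I x \<partial>\<mu>)"
  proof (rule integral_dominated_convergence[where w="\<lambda>_. 1"])
    show "?I \<in> borel_measurable \<mu>" using K by simp
    show "?E n \<in> borel_measurable \<mu>" for n
      by (intro continuous_measurable continuous_on_geometric_sum_mean \<omega>)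
    show "AE x in \<mu>. (\<lambda>n. ?E n x) \<longlonglongrightarrow> ?I x"
    proof (rule AE_I2)
      fix x
      show "(\<lambda>n. ?E n x) \<longlonglongrightarrow> ?I x"
      proof (cases "\<omega> x = 1")
        case True
        have "?E n x = 1" for n
        proof -
          have "(\<Sum>k<Suc n. \<omega> x ^ k) = of_nat (Suc n)" using True by simp
          then show ?thesis by (simp del: of_nat_Suc sum.lessThan_Suc)
        qed
        then show ?thesis using True by simp
      next
        case False
        then show ?thesis
          using geometric_sum_mean_tendsto_0[of "\<omega> x"] characters_cmod[OF \<omega>] by simp
      qed
    qed
    show "AE x in \<mu>. norm (?E n x) \<le> 1" for n
      using geometric_sum_mean_cmod_le[OF \<omega>] by (intro AE_I2)
  qed simp
  then have "(\<lambda>n. inverse (complex_of_nat (Suc n))) \<longlonglongrightarrow> (\<integral>x. ?I x \<partial>\<mu>)"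
    unfolding int .
  moreover have "(\<integral>x. ?I x \<partial>\<mu>) = of_real (measure \<mu> {x. \<omega> x = 1})"
  proof -
    have "?I = (\<lambda>x. complex_of_real (indicat_real {x. \<omega> x = 1} x))"
      by (auto simp: indicator_def)
    then show ?thesis using K by (simp add: space_haar)
  qed
  moreover have "(\<lambda>n. inverse (complex_of_nat (Suc n))) \<longlonglongrightarrow> 0"
    using LIMSEQ_Suc[OF lim_inverse_n[where 'a=complex]] by simp
  ultimately show ?thesis
    using LIMSEQ_unique by fastforce
qed

lemma AE_nontrivial:
  assumes \<omega>: "\<omega> \<in> characters" and free: "\<And>k. k > 0 \<Longrightarrow> (\<lambda>x. \<omega> x ^ k) \<noteq> (\<lambda>x. 1)"
  shows "AE x in \<mu>. \<omega> x \<noteq> 1"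
proof (rule AE_I)
  show "emeasure \<mu> {x. \<omega> x = 1} = 0"
    using measure_kernel[OF assms] by (simp add: emeasure_eq_measure)
  show "{x. \<omega> x = 1} \<in> sets \<mu>"
    using kernel_closed[OF \<omega>] by (simp add: sets_haar)
qed (simp add: space_haar)

text \<open>A Riemann-Lebesgue lemma in mean, which needs no density of trigonometric polynomials.\<close>

lemma constant_coefficients_zero:
  assumes v: "integrable \<mu> v" and \<eta>: "\<eta> \<in> characters" and ae: "AE x in \<mu>. \<eta> x \<noteq> 1"
    and c: "\<And>k. (\<integral>x. v x * \<eta> x ^ k \<partial>\<mu>) = c"
  shows "c = 0"
proof -
  let ?E = "\<lambda>n x. (\<Sum>k<Suc n. \<eta> x ^ k) / complex_of_nat (Suc n)"
  have "(\<integral>x. v x * ?E n x \<partial>\<mu>) = c" for n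
  proof -
    have i: "integrable \<mu> (\<lambda>x. v x * \<eta> x ^ k)" for k
      using v by (intro integrable_mult_continuous continuous_intros characters_continuous[OF \<eta>])
    have "(\<integral>x. v x * ?E n x \<partial>\<mu>) = (\<integral>x. (\<Sum>k<Suc n. v x * \<eta> x ^ k) / of_nat (Suc n) \<partial>\<mu>)"
      by (simp add: sum_distrib_left del: of_nat_Suc sum.lessThan_Suc)
    also have "\<dots> = (\<Sum>k<Suc n. c) / of_nat (Suc n)"
      using i c by (simp del: of_nat_Suc sum.lessThan_Suc)
    also have "\<dots> = c" by (simp del: of_nat_Suc sum.lessThan_Suc)
    finally show ?thesis .
  qed
  \<comment> \<open>The averages are bounded by 1 and tend to 0 wherever
    \<open>\<eta> x \<noteq> 1\<close>, so dominated convergence applies with majorant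
    \<open>cmod (v x)\<close>.\<close>
  moreover have "(\<lambda>n. \<integral>x. v x * ?E n x \<partial>\<mu>) \<longlonglongrightarrow> (\<integral>x. 0 \<partial>\<mu>)"
  proof (rule integral_dominated_convergence[where w="\<lambda>x. cmod (v x)"])
    show "integrable \<mu> (\<lambda>x. cmod (v x))" using v by simp
    show "(\<lambda>x. v x * ?E n x) \<in> borel_measurable \<mu>" for n
      using v by (intro borel_measurable_integrable integrable_mult_continuous continuous_on_geometric_sum_mean \<eta>)
    show "AE x in \<mu>. (\<lambda>n. v x * ?E n x) \<longlonglongrightarrow> 0"
      using ae
    proof eventually_elim
      case (elim x)
      then show ?case
        using geometric_sum_mean_tendsto_0[of "\<eta> x"] characters_cmod[OF \<eta>]
        by (intro tendsto_mult_right_zero) simp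
    qed
    show "AE x in \<mu>. norm (v x * ?E n x) \<le> cmod (v x)" for n
    proof (rule AE_I2)
      fix x show "norm (v x * ?E n x) \<le> cmod (v x)"
        unfolding norm_mult using geometric_sum_mean_cmod_le[OF \<eta>] by (intro mult_left_le) auto
    qed
  qed simp
  ultimately show ?thesis
    by (simp add: LIMSEQ_const_iff)
qed

text \<open>Since \<open>u\<close> times \<open>1 - \<omega>\<close> is 1 almost everywhere,
  consecutive coefficients of \<open>u\<close> differ by integrals of powers of
  \<open>\<omega>\<close>. Thus \<open>b\<close> is constant, \<open>a\<close> is constant from
  index 1 on, and both constants vanish, although \<open>a 0 = b 0\<close> and
  \<open>a 0 - a 1 = 1\<close>.\<close>

lemma inverse_one_minus_not_integrable:
  assumes \<omega>: "\<omega> \<in> characters" and free: "\<And>k. k > 0 \<Longrightarrow> (\<lambda>x. \<omega> x ^ k) \<noteq> (\<lambda>x. 1)"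
  shows "\<not> integrable \<mu> (\<lambda>x. 1 / (1 - \<omega> x))"
proof
  define u where "u x = 1 / (1 - \<omega> x)" for x
  assume "integrable \<mu> (\<lambda>x. 1 / (1 - \<omega> x))"
  then have u: "integrable \<mu> u" by (simp add: u_def[abs_def])
  note cont = characters_continuous[OF \<omega>]
  have ae: "AE x in \<mu>. \<omega> x \<noteq> 1" by (rule AE_nontrivial[OF \<omega> free])
  have i: "integrable \<mu> (\<lambda>x. u x * \<omega> x ^ k)" "integrable \<mu> (\<lambda>x. u x * cnj (\<omega> x) ^ k)" for k
    using u by (intro integrable_mult_continuous continuous_intros cont; simp)+
  have i': "integrable \<mu> (\<lambda>x. \<omega> x ^ k)" "integrable \<mu> (\<lambda>x. cnj (\<omega> x) ^ k)" for k
    by (intro continuous_integrable continuous_intros cont)+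
  define a where "a k = (\<integral>x. u x * \<omega> x ^ k \<partial>\<mu>)" for k
  define b where "b k = (\<integral>x. u x * cnj (\<omega> x) ^ k \<partial>\<mu>)" for k
  have a_step: "a k - a (Suc k) = (\<integral>x. \<omega> x ^ k \<partial>\<mu>)" for k
  proof -
    have "a k - a (Suc k) = (\<integral>x. u x * \<omega> x ^ k - u x * \<omega> x ^ Suc k \<partial>\<mu>)"
      unfolding a_def by (rule Bochner_Integration.integral_diff[symmetric, OF i(1) i(1)])
    also have "\<dots> = (\<integral>x. \<omega> x ^ k \<partial>\<mu>)"
    proof (rule integral_cong_AE)
      show "AE x in \<mu>. u x * \<omega> x ^ k - u x * \<omega> x ^ Suc k = \<omega> x ^ k"
        using ae
      proof eventually_elim
        case (elim x)
        have "u x * \<omega> x ^ k - u x * \<omega> x ^ Suc k = u x * (1 - \<omega> x) * \<omega> x ^ k" by (simp add: algebra_simps)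
        with elim show ?case by (simp add: u_def)
      qed
    qed (use i(1) i'(1) in \<open>auto intro!: borel_measurable_integrable simp del: power_Suc\<close>)
    finally show ?thesis .
  qed
  have b_step: "b (Suc k) - b k = 0" for k
  proof -
    have "b (Suc k) - b k = (\<integral>x. u x * cnj (\<omega> x) ^ Suc k - u x * cnj (\<omega> x) ^ k \<partial>\<mu>)"
      unfolding b_def by (rule Bochner_Integration.integral_diff[symmetric, OF i(2) i(2)])
    also have "\<dots> = (\<integral>x. cnj (\<omega> x) ^ Suc k \<partial>\<mu>)"
    proof (rule integral_cong_AE)
      show "AE x in \<mu>. u x * cnj (\<omega> x) ^ Suc k - u x * cnj (\<omega> x) ^ k = cnj (\<omega> x) ^ Suc k"
        using ae
      proof eventually_elim
        case (elim x)
        have "cnj (\<omega> x) ^ k = \<omega> x * cnj (\<omega> x) ^ Suc k"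
          using characters_mult_cnj[OF \<omega>, of x] by (simp add: mult.assoc[symmetric])
        then have "u x * cnj (\<omega> x) ^ Suc k - u x * cnj (\<omega> x) ^ k = u x * (1 - \<omega> x) * cnj (\<omega> x) ^ Suc k"
          by (simp add: algebra_simps)
        with elim show ?case by (simp add: u_def)
      qed
    qed (use i(2) i'(2) in \<open>auto intro!: borel_measurable_integrable simp del: power_Suc\<close>)
    also have "\<dots> = cnj (\<integral>x. \<omega> x ^ Suc k \<partial>\<mu>)"
      by (subst Bochner_Integration.integral_cnj[symmetric]) (simp only: complex_cnj_power)
    also have "(\<integral>x. \<omega> x ^ Suc k \<partial>\<mu>) = 0"
      by (intro integral_character characters_power \<omega> free) simp
    finally show ?thesis by simp
  qed
  have "b k = b 0" for k using b_step by (induction k) auto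
  then have "b 0 = 0"
    using ae by (intro constant_coefficients_zero[OF u characters_cnj[OF \<omega>], of "b 0"])
      (auto simp: b_def complex_cnj_one_iff elim!: eventually_mono)
  moreover have "a (Suc k) = a 1" for k
  proof (induction k)
    case (Suc k)
    have "(\<integral>x. \<omega> x ^ Suc k \<partial>\<mu>) = 0"
      by (intro integral_character characters_power \<omega> free) simp
    then show ?case using a_step[of "Suc k"] Suc by simp
  qed simp
  \<comment> \<open>The constant stretch of \<open>a\<close> starts at index 1, so the lemma is
    applied to \<open>u x * \<omega> x\<close>, whose coefficients are the
    \<open>a (Suc k)\<close>.\<close>
  then have "a 1 = 0"
    using i(1)[of 1] ae \<omega>
    by (intro constant_coefficients_zero[of "\<lambda>x. u x * \<omega> x" \<omega> "a 1"]) (auto simp: a_def mult.assoc)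
  moreover have "a 0 - a 1 = 1" using a_step[of 0] by (simp add: prob_space)
  moreover have "a 0 = b 0" by (simp add: a_def b_def)
  ultimately show False by simp
qed

text \<open>The means converge almost everywhere to \<open>1 / (1 - \<omega> x)\<close>; by Fatou a
  uniform bound \<open>C\<close> would make this limit integrable.\<close>

lemma geometric_mean_sum_L1_unbounded:
  assumes \<omega>: "\<omega> \<in> characters" and free: "\<And>k. k > 0 \<Longrightarrow> (\<lambda>x. \<omega> x ^ k) \<noteq> (\<lambda>x. 1)"
  shows "\<exists>N>0. C < L1norm \<mu> (\<lambda>x. geometric_mean_sum N (\<omega> x))"
proof (rule ccontr)
  assume "\<not> ?thesis"
  then have bound: "L1norm \<mu> (\<lambda>x. geometric_mean_sum (Suc n) (\<omega> x)) \<le> C" for n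
    by (auto simp: not_less)
  let ?s = "\<lambda>n x. geometric_mean_sum (Suc n) (\<omega> x)"
  have i: "integrable \<mu> (?s n)" for n
    by (intro continuous_integrable continuous_intros characters_continuous[OF \<omega>])
  have ae: "AE x in \<mu>. \<omega> x \<noteq> 1" by (rule AE_nontrivial[OF assms])
  have lim: "AE x in \<mu>. (\<lambda>n. ?s n x) \<longlonglongrightarrow> 1 / (1 - \<omega> x)"
    using ae by eventually_elim (simp add: geometric_mean_sum_tendsto characters_cmod[OF \<omega>])
  have "(\<integral>\<^sup>+x. ennreal (cmod (1 / (1 - \<omega> x))) \<partial>\<mu>) = (\<integral>\<^sup>+x. liminf (\<lambda>n. ennreal (cmod (?s n x))) \<partial>\<mu>)"
  proof (rule nn_integral_cong_AE)
    show "AE x in \<mu>. ennreal (cmod (1 / (1 - \<omega> x))) = liminf (\<lambda>n. ennreal (cmod (?s n x)))"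
      using lim
    proof eventually_elim
      case (elim x)
      then have "(\<lambda>n. ennreal (cmod (?s n x))) \<longlonglongrightarrow> ennreal (cmod (1 / (1 - \<omega> x)))"
        by (intro tendsto_ennrealI tendsto_norm)
      then show ?case using lim_imp_Liminf[OF sequentially_bot] by metis
    qed
  qed
  also have "\<dots> \<le> liminf (\<lambda>n. \<integral>\<^sup>+x. ennreal (cmod (?s n x)) \<partial>\<mu>)"
    using i by (intro nn_integral_liminf) auto
  also have "\<dots> \<le> ennreal C"
  proof (rule Liminf_le)
    have "(\<integral>\<^sup>+x. ennreal (cmod (?s n x)) \<partial>\<mu>) \<le> ennreal C" for n
      using bound[of n] i[of n] by (subst nn_integral_eq_integral) (auto simp: L1norm_def intro!: ennreal_leI)
    then show "eventually (\<lambda>n. (\<integral>\<^sup>+x. ennreal (cmod (?s n x)) \<partial>\<mu>) \<le> ennreal C) sequentially"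
      by simp
  qed simp
  finally have "(\<integral>\<^sup>+x. ennreal (cmod (1 / (1 - \<omega> x))) \<partial>\<mu>) < \<infinity>"
    using ennreal_less_top order_le_less_trans by fastforce
  moreover have "(\<lambda>x. 1 / (1 - \<omega> x)) \<in> borel_measurable \<mu>"
    using continuous_measurable[OF characters_continuous[OF \<omega>]] by measurable
  ultimately have "integrable \<mu> (\<lambda>x. 1 / (1 - \<omega> x))"
    by (intro integrableI_bounded)
  with inverse_one_minus_not_integrable[OF assms] show False by blast
qed

end

section \<open>Projections and Riesz sets\<close>

context compact_haar
begin

section \<open>Square integrable functions and uniqueness of the projection\<close>

lemma L2_mult_integrable:
  assumes "f \<in> L2 \<mu>" "g \<in> L2 \<mu>"
  shows "integrable \<mu> (\<lambda>x. f x * cnj (g x))"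
proof (rule Bochner_Integration.integrable_bound)
  show "integrable \<mu> (\<lambda>x. (cmod (f x))\<^sup>2 + (cmod (g x))\<^sup>2)"
    using assms by (simp add: L2_def)
  have "g \<in> borel_measurable \<mu>" using assms by (simp add: L2_def)
  then have "(\<lambda>x. cnj (g x)) \<in> borel_measurable \<mu>"
    by (rule measurable_compose) (intro borel_measurable_continuous_onI continuous_intros)
  then show "(\<lambda>x. f x * cnj (g x)) \<in> borel_measurable \<mu>"
    using assms(1) by (intro borel_measurable_times) (auto simp: L2_def)
  have "cmod (f x * cnj (g x)) \<le> norm ((cmod (f x))\<^sup>2 + (cmod (g x))\<^sup>2)" for x
  proof -
    have "0 \<le> cmod (f x) * cmod (g x)" by simp
    then have "cmod (f x) * cmod (g x) \<le> (cmod (f x))\<^sup>2 + (cmod (g x))\<^sup>2"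
      using sum_squares_bound[of "cmod (f x)" "cmod (g x)"] by linarith
    then show ?thesis by (simp add: norm_mult)
  qed
  then show "AE x in \<mu>. cmod (f x * cnj (g x)) \<le> norm ((cmod (f x))\<^sup>2 + (cmod (g x))\<^sup>2)"
    by simp
qed

lemma L2_diff:
  assumes "f \<in> L2 \<mu>" "g \<in> L2 \<mu>"
  shows "(\<lambda>x. f x - g x) \<in> L2 \<mu>"
proof -
  have m: "f \<in> borel_measurable \<mu>" "g \<in> borel_measurable \<mu>" using assms by (auto simp: L2_def)
  have "integrable \<mu> (\<lambda>x. (cmod (f x - g x))\<^sup>2)"
  proof (rule Bochner_Integration.integrable_bound)
    show "integrable \<mu> (\<lambda>x. 2 * (cmod (f x))\<^sup>2 + 2 * (cmod (g x))\<^sup>2)"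
      using assms by (simp add: L2_def)
    show "(\<lambda>x. (cmod (f x - g x))\<^sup>2) \<in> borel_measurable \<mu>"
      using m by measurable
    have "(cmod (f x - g x))\<^sup>2 \<le> 2 * (cmod (f x))\<^sup>2 + 2 * (cmod (g x))\<^sup>2" for x
    proof -
      have "(cmod (f x - g x))\<^sup>2 \<le> (cmod (f x) + cmod (g x))\<^sup>2"
        by (intro power_mono norm_triangle_ineq4) simp
      also have "\<dots> \<le> 2 * (cmod (f x))\<^sup>2 + 2 * (cmod (g x))\<^sup>2"
        using sum_squares_bound[of "cmod (f x)" "cmod (g x)"] by (simp add: power2_sum)
      finally show ?thesis .
    qed
    then show "AE x in \<mu>. norm ((cmod (f x - g x))\<^sup>2) \<le> norm (2 * (cmod (f x))\<^sup>2 + 2 * (cmod (g x))\<^sup>2)"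
      by simp
  qed
  then show ?thesis using m by (simp add: L2_def)
qed

lemma continuous_L2: "continuous_on UNIV f \<Longrightarrow> f \<in> L2 \<mu>"
  unfolding L2_def by (auto intro!: continuous_measurable continuous_integrable continuous_intros)

lemma L2_integrable:
  assumes "f \<in> L2 \<mu>"
  shows "integrable \<mu> f"
  using L2_mult_integrable[OF assms continuous_L2[of "\<lambda>_. 1"]] by simp

lemma H_space_diff:
  assumes "f \<in> H_space \<mu> \<Gamma>" "g \<in> H_space \<mu> \<Gamma>"
  shows "(\<lambda>x. f x - g x) \<in> H_space \<mu> \<Gamma>"
proof -
  have L: "f \<in> L2 \<mu>" "g \<in> L2 \<mu>" using assms by (auto simp: H_space_def)
  have "fourier \<mu> (\<lambda>x. f x - g x) \<xi> = fourier \<mu> f \<xi> - fourier \<mu> g \<xi>" if "\<xi> \<in> characters" for \<xi>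
    unfolding fourier_def left_diff_distrib
    by (intro Bochner_Integration.integral_diff L2_mult_integrable L continuous_L2 characters_continuous that)
  then show ?thesis using assms L2_diff[OF L] by (auto simp: H_space_def)
qed

text \<open>The difference \<open>d\<close> of two projections lies in \<open>H_space\<close> and is
  orthogonal to it, so it is orthogonal to itself. This identifies \<open>T f\<close> with an
  explicitly known projection.\<close>

lemma orth_proj_AE_unique:
  assumes f: "f \<in> L2 \<mu>" and g: "is_orth_proj \<mu> \<Gamma> f g" and h: "is_orth_proj \<mu> \<Gamma> f h"
  shows "AE x in \<mu>. g x = h x"
proof -
  define d where "d x = g x - h x" for x
  have gh: "g \<in> H_space \<mu> \<Gamma>" "h \<in> H_space \<mu> \<Gamma>"
    using g h by (auto simp: is_orth_proj_def)
  then have d: "d \<in> H_space \<mu> \<Gamma>"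
    unfolding d_def by (rule H_space_diff)
  have L: "g \<in> L2 \<mu>" "h \<in> L2 \<mu>" "d \<in> L2 \<mu>" using gh d by (auto simp: H_space_def)
  have z: "(\<integral>x. (f x - g x) * cnj (d x) \<partial>\<mu>) = 0" "(\<integral>x. (f x - h x) * cnj (d x) \<partial>\<mu>) = 0"
    using g h d by (auto simp: is_orth_proj_def)
  have "(\<integral>x. complex_of_real ((cmod (d x))\<^sup>2) \<partial>\<mu>) = (\<integral>x. (f x - h x) * cnj (d x) - (f x - g x) * cnj (d x) \<partial>\<mu>)"
    by (simp only: complex_norm_square) (simp add: d_def algebra_simps)
  also have "\<dots> = 0"
    by (subst Bochner_Integration.integral_diff) (use f L z in \<open>auto intro!: L2_mult_integrable L2_diff\<close>)
  finally have "(\<integral>x. (cmod (d x))\<^sup>2 \<partial>\<mu>) = 0"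
    by (simp only: integral_complex_of_real of_real_eq_0_iff)
  moreover have "integrable \<mu> (\<lambda>x. (cmod (d x))\<^sup>2)" using L by (simp add: L2_def)
  ultimately have "AE x in \<mu>. (cmod (d x))\<^sup>2 = 0"
    using integral_nonneg_eq_0_iff_AE[of \<mu> "\<lambda>x. (cmod (d x))\<^sup>2"] by simp
  then show ?thesis by (simp add: d_def)
qed

text \<open>The powers of \<open>\<omega>\<close> with exponent at least 0 lie in
  \<open>\<Gamma>\<close> and the others do not, so the projection cuts the kernel down to its
  analytic part.\<close>

lemma orth_proj_fejer:
  assumes \<Gamma>: "submonoid_dual \<Gamma>" and \<omega>: "\<omega> \<in> \<Gamma>" "(\<lambda>x. cnj (\<omega> x)) \<notin> \<Gamma>" and "N > 0"
  shows "is_orth_proj \<mu> \<Gamma> (\<lambda>x. complex_of_real (fejer N (\<omega> x))) (\<lambda>x. geometric_mean_sum N (\<omega> x))"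
  unfolding is_orth_proj_def
proof (intro conjI ballI)
  have sub: "\<Gamma> \<subseteq> characters" and one: "(\<lambda>x. 1) \<in> \<Gamma>"
    and mult: "\<And>\<xi> \<eta>. \<xi> \<in> \<Gamma> \<Longrightarrow> \<eta> \<in> \<Gamma> \<Longrightarrow> (\<lambda>x. \<xi> x * \<eta> x) \<in> \<Gamma>"
    using \<Gamma> by (auto simp: submonoid_dual_def)
  have ch: "\<omega> \<in> characters" using \<omega> sub by blast
  note cont = characters_continuous[OF ch]
  have pow: "(\<lambda>x. \<omega> x ^ k) \<in> \<Gamma>" for k
    by (induction k) (use one mult \<omega> in auto)
  \<comment> \<open>If a negative power of exponent \<open>- k\<close> were in
    \<open>\<Gamma>\<close>, multiplying it by \<open>\<omega> x ^ (k - 1)\<close> would put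
    \<open>cnj (\<omega> x)\<close> there as well.\<close>
  have neg: "(\<lambda>x. cnj (\<omega> x) ^ k) \<notin> \<Gamma>" if k: "k > 0" for k
  proof
    assume *: "(\<lambda>x. cnj (\<omega> x) ^ k) \<in> \<Gamma>"
    obtain i where i: "k = Suc i" using k by (cases k) auto
    have "(\<lambda>x. cnj (\<omega> x) ^ k * \<omega> x ^ i) = (\<lambda>x. cnj (\<omega> x))"
    proof
      fix x
      have "cnj (\<omega> x) ^ k * \<omega> x ^ i = cnj (\<omega> x) * (\<omega> x * cnj (\<omega> x)) ^ i"
        by (simp add: i power_mult_distrib mult_ac)
      then show "cnj (\<omega> x) ^ k * \<omega> x ^ i = cnj (\<omega> x)" by (simp add: characters_mult_cnj[OF ch])
    qed
    with mult[OF * pow[of i]] \<omega>(2) show False by simp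
  qed
  show "(\<lambda>x. geometric_mean_sum N (\<omega> x)) \<in> H_space \<mu> \<Gamma>"
    unfolding H_space_def
  proof safe
    show "(\<lambda>x. geometric_mean_sum N (\<omega> x)) \<in> L2 \<mu>"
      by (intro continuous_L2 continuous_intros cont)
  next
    fix \<xi> :: "'a \<Rightarrow> complex" assume \<xi>: "\<xi> \<in> characters" "\<xi> \<notin> \<Gamma>"
    have z: "(\<integral>x. cnj (\<xi> x) * \<omega> x ^ k \<partial>\<mu>) = 0" for k
    proof -
      have "(\<lambda>x. \<omega> x ^ k) \<noteq> \<xi>" using pow \<xi>(2) by auto
      from character_orthogonality[OF characters_power[OF ch] \<xi>(1) this]
      show ?thesis by (simp add: mult.commute)
    qed
    have "(\<integral>x. cnj (\<xi> x) * geometric_mean_sum N (\<omega> x) \<partial>\<mu>) = (\<integral>x. cnj (\<xi> x) \<partial>\<mu>)"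
      using \<xi> ch \<open>N > 0\<close> z
      by (intro integral_geometric_mean_sum continuous_integrable continuous_intros characters_continuous)
    also have "\<dots> = 0" using z[of 0] by simp
    finally show "fourier \<mu> (\<lambda>x. geometric_mean_sum N (\<omega> x)) \<xi> = 0"
      by (simp add: fourier_def mult.commute)
  qed
  fix h assume h: "h \<in> H_space \<mu> \<Gamma>"
  then have hi: "integrable \<mu> h" by (auto simp: H_space_def intro: L2_integrable)
  then have hi': "integrable \<mu> (\<lambda>x. cnj (h x))" by simp
  have "(\<integral>x. cnj (h x) * cnj (\<omega> x) ^ k \<partial>\<mu>) = 0" if "k > 0" for k
  proof -
    have "(\<lambda>x. cnj (\<omega> x) ^ k) \<in> characters - \<Gamma>"
      using neg[OF that] ch by (auto intro: characters_power characters_cnj)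
    then have "fourier \<mu> h (\<lambda>x. cnj (\<omega> x) ^ k) = 0" using h by (auto simp: H_space_def)
    then have "cnj (\<integral>x. h x * \<omega> x ^ k \<partial>\<mu>) = 0" by (simp add: fourier_def)
    then show ?thesis by (subst (asm) Bochner_Integration.integral_cnj[symmetric]) simp
  qed
  \<comment> \<open>Of the antianalytic part only the constant term survives against
    \<open>cnj (h x)\<close>; it cancels the -1 in \<open>complex_fejer\<close>.\<close>
  then have eq: "(\<integral>x. cnj (h x) * geometric_mean_sum N (cnj (\<omega> x)) \<partial>\<mu>) = (\<integral>x. cnj (h x) \<partial>\<mu>)"
    using hi' ch \<open>N > 0\<close> by (intro integral_geometric_mean_sum characters_cnj)
  have "(\<integral>x. (complex_of_real (fejer N (\<omega> x)) - geometric_mean_sum N (\<omega> x)) * cnj (h x) \<partial>\<mu>)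
      = (\<integral>x. cnj (h x) * geometric_mean_sum N (cnj (\<omega> x)) - cnj (h x) \<partial>\<mu>)"
    unfolding complex_fejer by (simp add: algebra_simps)
  also have "\<dots> = 0"
    using hi' eq
    by (subst Bochner_Integration.integral_diff)
      (auto intro!: integrable_mult_continuous continuous_intros cont)
  finally show "(\<integral>x. (complex_of_real (fejer N (\<omega> x)) - geometric_mean_sum N (\<omega> x)) * cnj (h x) \<partial>\<mu>) = 0" .
qed

text \<open>The test functions are Fejer kernels: their norm 1 lets \<open>C\<close> be compared
  directly with the unbounded norms of their analytic parts.\<close>

lemma projection_L1_unbounded:
  assumes \<Gamma>: "submonoid_dual \<Gamma>" and \<omega>: "\<omega> \<in> \<Gamma>" "(\<lambda>x. cnj (\<omega> x)) \<notin> \<Gamma>"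
    and free: "\<And>k. k > 0 \<Longrightarrow> (\<lambda>x. \<omega> x ^ k) \<noteq> (\<lambda>x. 1)"
    and proj: "\<And>f. f \<in> L2 \<mu> \<Longrightarrow> is_orth_proj \<mu> \<Gamma> f (T f)"
  shows "\<exists>f. integrable \<mu> f \<and> C * L1norm \<mu> f < L1norm \<mu> (T f)"
proof -
  have ch: "\<omega> \<in> characters" using \<Gamma> \<omega> by (auto simp: submonoid_dual_def)
  note cont = characters_continuous[OF ch]
  obtain N where N: "N > 0" "C < L1norm \<mu> (\<lambda>x. geometric_mean_sum N (\<omega> x))"
    using geometric_mean_sum_L1_unbounded[OF ch free] by blast
  define f where "f x = complex_of_real (fejer N (\<omega> x))" for x
  have fc: "continuous_on UNIV f"
    unfolding f_def by (intro continuous_intros cont)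
  then have f: "f \<in> L2 \<mu>" by (rule continuous_L2)
  have P: "is_orth_proj \<mu> \<Gamma> f (T f)" by (rule proj[OF f])
  have "is_orth_proj \<mu> \<Gamma> f (\<lambda>x. geometric_mean_sum N (\<omega> x))"
    unfolding f_def by (rule orth_proj_fejer[OF \<Gamma> \<omega> N(1)])
  then have "AE x in \<mu>. T f x = geometric_mean_sum N (\<omega> x)"
    by (rule orth_proj_AE_unique[OF f P])
  moreover have "T f \<in> borel_measurable \<mu>"
    using P by (auto simp: is_orth_proj_def H_space_def L2_def)
  moreover have "(\<lambda>x. geometric_mean_sum N (\<omega> x)) \<in> borel_measurable \<mu>"
    by (intro continuous_measurable continuous_intros cont)
  ultimately have "L1norm \<mu> (T f) = L1norm \<mu> (\<lambda>x. geometric_mean_sum N (\<omega> x))"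
    unfolding L1norm_def by (intro integral_cong_AE) (auto elim!: eventually_mono)
  moreover have "L1norm \<mu> f = 1"
    using integral_fejer[OF ch free N(1)] fejer_nonneg[OF characters_cmod[OF ch] N(1)]
    by (simp add: L1norm_def f_def)
  ultimately show ?thesis
    using N(2) continuous_integrable[OF fc] by (intro exI[of _ f]) simp
qed

text \<open>Both properties pass to a weak cluster point of the measures with Fejer densities
  because they are tested on continuous functions: characters for the spectrum, and
  \<open>q\<close>, which vanishes exactly where \<open>\<omega> x = 1\<close>, for the
  concentration.\<close>

lemma exists_singular_measure:
  fixes \<omega> :: "'a \<Rightarrow> complex"
  assumes \<omega>: "\<omega> \<in> characters" and free: "\<And>k. k > 0 \<Longrightarrow> (\<lambda>x. \<omega> x ^ k) \<noteq> (\<lambda>x. 1)"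
  obtains \<nu> where "regular_measure \<nu>" "measure \<nu> {x. \<omega> x = 1} = 1"
    "\<And>\<xi>. \<xi> \<in> characters \<Longrightarrow> (\<And>k. \<xi> \<noteq> (\<lambda>x. \<omega> x ^ k)) \<Longrightarrow> (\<And>k. \<xi> \<noteq> (\<lambda>x. cnj (\<omega> x) ^ k))
      \<Longrightarrow> (\<integral>x. \<xi> x \<partial>\<nu>) = 0"
proof -
  note cont = characters_continuous[OF \<omega>]
  \<comment> \<open>The index \<open>Suc n\<close> avoids the degenerate kernel at 0, so that every
    \<open>F n\<close> is a probability density.\<close>
  define F where "F n x = fejer (Suc n) (\<omega> x)" for n x
  define M where "M n = density \<mu> (\<lambda>x. ennreal (F n x))" for n
  have F_cont: "continuous_on UNIV (F n)" for n
    unfolding F_def by (intro continuous_intros cont)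
  have F_nonneg: "0 \<le> F n x" for n x
    unfolding F_def by (rule fejer_nonneg[OF characters_cmod[OF \<omega>]]) simp
  have F_meas: "F n \<in> borel_measurable \<mu>" for n by (rule continuous_measurable[OF F_cont])
  have sets_M: "sets (M n) = sets borel" for n by (simp add: M_def sets_haar)
  have prob_M: "prob_space (M n)" for n
  proof (rule prob_spaceI)
    have "emeasure (M n) (space (M n)) = (\<integral>\<^sup>+x. ennreal (F n x) \<partial>\<mu>)"
      unfolding M_def using F_meas[of n] by (subst emeasure_density) (auto simp: space_haar sets_haar)
    also have "\<dots> = ennreal (\<integral>x. F n x \<partial>\<mu>)"
      by (rule nn_integral_eq_integral[OF continuous_integrable[OF F_cont]]) (simp add: F_nonneg)
    finally show "emeasure (M n) (space (M n)) = 1"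
      using integral_fejer[OF \<omega> free, of "Suc n"] by (simp add: F_def)
  qed
  have int_M: "(\<integral>x. f x \<partial>M n) = (\<integral>x. F n x * f x \<partial>\<mu>)" if "continuous_on UNIV f" for f :: "'a \<Rightarrow> real" and n
    unfolding M_def
    by (subst integral_real_density) (use F_nonneg F_meas continuous_measurable[OF that] in auto)
  obtain G \<nu> where G: "G \<noteq> bot" "G \<le> sequentially" and reg: "regular_measure \<nu>" and prob: "prob_space \<nu>"
    and lim: "\<And>f :: 'a \<Rightarrow> real. continuous_on UNIV f \<Longrightarrow> ((\<lambda>n. \<integral>x. f x \<partial>M n) \<longlongrightarrow> (\<integral>x. f x \<partial>\<nu>)) G"
    by (rule prob_weak_cluster_point[of M, OF compact_group prob_M sets_M]) blast
  interpret \<nu>: prob_space \<nu> by (rule prob)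
  have sets_\<nu>: "sets \<nu> = sets borel" using reg by (simp add: regular_measure_def)
  then have sp_\<nu>: "space \<nu> = UNIV" using sets_eq_imp_space_eq by fastforce
  have meas_\<nu>: "f \<in> borel_measurable \<nu>" if "continuous_on UNIV f" for f :: "'a \<Rightarrow> 'b::topological_space"
    using borel_measurable_continuous_onI[OF that] sets_\<nu> measurable_cong_sets by blast
  have int_\<nu>: "integrable \<nu> f" if f: "continuous_on UNIV f" for f :: "'a \<Rightarrow> 'b::{banach, second_countable_topology}"
  proof -
    obtain B where "\<And>x. norm (f x) \<le> B" using continuous_bounded[OF f] by blast
    then show ?thesis
      using meas_\<nu>[OF f] by (intro \<nu>.integrable_const_bound[where B=B]) auto
  qed
  define q where "q x = (cmod (1 - \<omega> x))\<^sup>2" for x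
  have q: "continuous_on UNIV q" unfolding q_def by (intro continuous_intros cont)
  have "(\<lambda>n. \<integral>x. q x \<partial>M n) \<longlonglongrightarrow> 0"
  proof (rule tendsto_sandwich[OF _ _ tendsto_const])
    have "0 \<le> (\<integral>x. q x \<partial>M n)" for n by (simp add: q_def)
    then show "eventually (\<lambda>n. 0 \<le> (\<integral>x. q x \<partial>M n)) sequentially" by simp
    have "(\<integral>x. q x \<partial>M n) \<le> 4 * inverse (real (Suc n))" for n
    proof -
      have "(\<integral>x. F n x * q x \<partial>\<mu>) \<le> (\<integral>x. 4 / real (Suc n) \<partial>\<mu>)"
      proof (rule integral_mono)
        show "integrable \<mu> (\<lambda>x. F n x * q x)"
          by (intro continuous_integrable continuous_intros F_cont q)
        show "F n x * q x \<le> 4 / real (Suc n)" for x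
          unfolding F_def q_def by (rule fejer_times_sq_le[OF characters_cmod[OF \<omega>]]) simp
      qed simp
      then show ?thesis unfolding int_M[OF q] by (simp add: prob_space divide_inverse del: of_nat_Suc)
    qed
    then show "eventually (\<lambda>n. (\<integral>x. q x \<partial>M n) \<le> 4 * inverse (real (Suc n))) sequentially" by simp
    show "(\<lambda>n. 4 * inverse (real (Suc n))) \<longlonglongrightarrow> 0"
      by (intro tendsto_mult_right_zero LIMSEQ_inverse_real_of_nat)
  qed
  then have "((\<lambda>n. \<integral>x. q x \<partial>M n) \<longlongrightarrow> 0) G" by (rule tendsto_mono[OF G(2)])
  then have "(\<integral>x. q x \<partial>\<nu>) = 0" using tendsto_unique[OF G(1) lim[OF q]] by blast
  then have "AE x in \<nu>. q x = 0"
    by (subst (asm) integral_nonneg_eq_0_iff_AE[OF int_\<nu>[OF q]]) (simp_all add: q_def)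
  then have "AE x in \<nu>. x \<in> {x. \<omega> x = 1}"
    by eventually_elim (simp add: q_def)
  then have one: "measure \<nu> {x. \<omega> x = 1} = 1"
    using kernel_closed[OF \<omega>] sets_\<nu> by (intro \<nu>.prob_eq_1[THEN iffD2]) auto
  have "(\<integral>x. \<xi> x \<partial>\<nu>) = 0"
    if \<xi>: "\<xi> \<in> characters" and ne: "\<And>k. \<xi> \<noteq> (\<lambda>x. \<omega> x ^ k)" "\<And>k. \<xi> \<noteq> (\<lambda>x. cnj (\<omega> x) ^ k)" for \<xi>
  proof -
    note c\<xi> = characters_continuous[OF \<xi>]
    have i: "integrable \<mu> (\<lambda>x. \<xi> x * complex_of_real (F n x))" for n
      by (intro continuous_integrable continuous_intros c\<xi> F_cont)
    have z: "(\<integral>x. \<xi> x * complex_of_real (F n x) \<partial>\<mu>) = 0" for n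
      unfolding F_def by (rule integral_character_fejer[OF \<omega> \<xi> _ ne]) simp
    \<comment> \<open>Weak convergence is available for real functions, so real and imaginary parts
      are treated separately.\<close>
    have cR: "continuous_on UNIV (\<lambda>x. Re (\<xi> x))" and cI: "continuous_on UNIV (\<lambda>x. Im (\<xi> x))"
      by (intro continuous_intros c\<xi>)+
    have "(\<integral>x. Re (\<xi> x) \<partial>M n) = 0" for n
      using integral_Re[OF i[of n]] unfolding int_M[OF cR] z by (simp add: mult.commute)
    then have R: "(\<integral>x. Re (\<xi> x) \<partial>\<nu>) = 0"
      using tendsto_unique[OF G(1) lim[OF cR], of 0] by simp
    have "(\<integral>x. Im (\<xi> x) \<partial>M n) = 0" for n
      using integral_Im[OF i[of n]] unfolding int_M[OF cI] z by (simp add: mult.commute)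
    then have I: "(\<integral>x. Im (\<xi> x) \<partial>\<nu>) = 0"
      using tendsto_unique[OF G(1) lim[OF cI], of 0] by simp
    show ?thesis
      using R I integral_Re[OF int_\<nu>[OF c\<xi>]] integral_Im[OF int_\<nu>[OF c\<xi>]] by (simp add: complex_eq_iff)
  qed
  with reg one show thesis by (rule that)
qed

lemma not_riesz_set:
  assumes \<omega>: "\<omega> \<in> characters" and free: "\<And>k. k > 0 \<Longrightarrow> (\<lambda>x. \<omega> x ^ k) \<noteq> (\<lambda>x. 1)"
    and \<Gamma>: "\<And>k. (\<lambda>x. \<omega> x ^ k) \<in> \<Gamma>" "\<And>k. (\<lambda>x. cnj (\<omega> x) ^ k) \<in> \<Gamma>"
  shows "\<not> riesz_set \<mu> \<Gamma>"
proof
  assume riesz: "riesz_set \<mu> \<Gamma>"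
  obtain \<nu> where reg: "regular_measure \<nu>" and one: "measure \<nu> {x. \<omega> x = 1} = 1"
    and zero: "\<And>\<xi>. \<xi> \<in> characters \<Longrightarrow> (\<And>k. \<xi> \<noteq> (\<lambda>x. \<omega> x ^ k)) \<Longrightarrow> (\<And>k. \<xi> \<noteq> (\<lambda>x. cnj (\<omega> x) ^ k))
      \<Longrightarrow> (\<integral>x. \<xi> x \<partial>\<nu>) = 0"
    using exists_singular_measure[OF \<omega> free] by metis
  \<comment> \<open>A positive measure as a \<open>cmeasure\<close>: the other three components are
    zero.\<close>
  define Z :: "'a measure" where "Z = null_measure borel"
  have Z: "regular_measure Z"
  proof -
    have "(INF U\<in>{U. open U \<and> A \<subseteq> U}. emeasure Z U) = 0" for A
    proof -
      \<comment> \<open>The infimum over an empty family would be infinite instead of 0.\<close>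
      have "{U. open U \<and> A \<subseteq> U} \<noteq> {}" by auto
      then show ?thesis by (simp add: Z_def)
    qed
    moreover have "(SUP K\<in>{K. compact K \<and> K \<subseteq> U}. emeasure Z K) = 0" for U
    proof -
      have "{K. compact K \<and> K \<subseteq> U} \<noteq> {}" by auto
      then show ?thesis by (simp add: Z_def)
    qed
    ultimately show ?thesis
      by (auto simp: regular_measure_def Z_def intro!: finite_measureI)
  qed
  have "cm_fourier (\<nu>, Z, Z, Z) \<xi> = 0" if "\<xi> \<in> characters - \<Gamma>" for \<xi>
  proof -
    \<comment> \<open>The coefficient in \<open>cm_fourier\<close> is the conjugate of this
      integral, as \<open>\<nu>\<close> is positive.\<close>
    have "(\<integral>x. \<xi> x \<partial>\<nu>) = 0" using that \<Gamma> by (intro zero) auto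
    then show ?thesis by (simp add: cm_fourier_def Z_def)
  qed
  then have "cm_abs_cont \<mu> (\<nu>, Z, Z, Z)"
    using riesz reg Z by (auto simp: riesz_set_def cm_regular_def)
  moreover have "{x. \<omega> x = 1} \<in> sets \<mu>"
    using kernel_closed[OF \<omega>] by (simp add: sets_haar)
  ultimately have "cm_val (\<nu>, Z, Z, Z) {x. \<omega> x = 1} = 0"
    using measure_kernel[OF \<omega> free] by (auto simp: cm_abs_cont_def emeasure_eq_measure)
  moreover have "measure Z {x. \<omega> x = 1} = 0"
    by (simp add: Z_def measure_def)
  ultimately show False by (simp add: cm_val_def one)
qed

end

section \<open>The dichotomy: is the conjugate of a nontrivial character of \<open>\<Gamma>\<close>
  again in \<open>\<Gamma>\<close>?\<close>

theorem theorem3p9: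
  fixes \<mu> :: "'a::{topological_ab_group_add, t2_space} measure"
    and \<Gamma> :: "('a \<Rightarrow> complex) set"
  assumes "compact (UNIV :: 'a set)" and "connected (UNIV :: 'a set)"
    and "haar_prob \<mu>"
    and "submonoid_dual \<Gamma>"
    and "\<Gamma> \<noteq> {\<lambda>x. 1}"
    and "riesz_set \<mu> \<Gamma>"
  shows "\<not> (\<exists>(T :: ('a \<Rightarrow> complex) \<Rightarrow> ('a \<Rightarrow> complex)) (C :: real).
            (\<forall>f. integrable \<mu> f \<longrightarrow> integrable \<mu> (T f) \<and> L1norm \<mu> (T f) \<le> C * L1norm \<mu> f)
          \<and> (\<forall>f g a b. integrable \<mu> f \<and> integrable \<mu> g \<longrightarrow>
               (AE x in \<mu>. T (\<lambda>y. a * f y + b * g y) x = a * T f x + b * T g x))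
          \<and> (\<forall>f\<in>L2 \<mu>. is_orth_proj \<mu> \<Gamma> f (T f)))"
proof (rule notI, elim exE conjE)
  fix T :: "('a \<Rightarrow> complex) \<Rightarrow> ('a \<Rightarrow> complex)" and C :: real
  assume bound: "\<forall>f. integrable \<mu> f \<longrightarrow> integrable \<mu> (T f) \<and> L1norm \<mu> (T f) \<le> C * L1norm \<mu> f"
    and proj: "\<forall>f\<in>L2 \<mu>. is_orth_proj \<mu> \<Gamma> f (T f)"
  interpret compact_haar \<mu> by (rule compact_haar.intro[OF assms(1,3)])
  have sub: "\<Gamma> \<subseteq> characters" and one: "(\<lambda>x. 1) \<in> \<Gamma>"
    and mult: "\<And>\<xi> \<eta>. \<xi> \<in> \<Gamma> \<Longrightarrow> \<eta> \<in> \<Gamma> \<Longrightarrow> (\<lambda>x. \<xi> x * \<eta> x) \<in> \<Gamma>"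
    using assms(4) by (auto simp: submonoid_dual_def)
  obtain \<omega> where \<omega>: "\<omega> \<in> \<Gamma>" "\<omega> \<noteq> (\<lambda>x. 1)" using one assms(5) by blast
  then have ch: "\<omega> \<in> characters" using sub by blast
  have free: "(\<lambda>x. \<omega> x ^ k) \<noteq> (\<lambda>x. 1)" if "k > 0" for k
    by (rule character_power_nontrivial[OF assms(2) ch \<omega>(2) that])
  have pow: "(\<lambda>x. \<xi> x ^ k) \<in> \<Gamma>" if "\<xi> \<in> \<Gamma>" for \<xi> k
    by (induction k) (use one mult that in auto)
  show False
  proof (cases "(\<lambda>x. cnj (\<omega> x)) \<in> \<Gamma>")
    case True
    have "\<not> riesz_set \<mu> \<Gamma>"
      by (rule not_riesz_set[OF ch free pow[OF \<omega>(1)] pow[OF True]])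
    with assms(6) show False by simp
  next
    case False
    have "\<exists>f. integrable \<mu> f \<and> C * L1norm \<mu> f < L1norm \<mu> (T f)"
      by (rule projection_L1_unbounded[OF assms(4) \<omega>(1) False free]) (use proj in simp_all)
    then obtain f where "integrable \<mu> f" "C * L1norm \<mu> f < L1norm \<mu> (T f)"
      by (elim exE conjE)
    then show False using bound by (simp add: not_less[symmetric])
  qed
qed

end
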